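(* There exist constants $K>0$ and $\kappa>0$ such that for all $d,N\in\mathbb{N}$ with $d\ge 2$ and $N\ge 1600\,d$, the star discrepancy $D^*_N(X)$ of a Latin hypercube sample $X=(X_n)_{n\in[N]}$ in $[0,1)^d$ satisfies $$\mathrm{E}\big[D^*_N(X)\big]\ \ge\ K\sqrt{\frac{d}{N}}$$ and $$\mathrm{P}\left(D^*_N(X)<K\sqrt{\frac{d}{N}}\right)\ \le\ \exp(-\kappa d).$$ (The second bound is the statement $\mathrm{P}\big(D^*_N(X)<K\sqrt{d/N}\big)\le \exp(-\Omega(d))$ with the implied constant written out as $\kappa$; $K$ and $\kappa$ do not depend on $d$ or $N$.)
   Context: For $N\in\mathbb{N}$ write $[N]=\{1,2,\ldots,N\}$. Star discrepancy: an $N$-point set $P$ in $[0,1)^d$ is understood as a multiset of $N$ (not necessarily distinct) points. For a Lebesgue-measurable set $T\subseteq[0,1)^d$, the local discrepancy is $D_N(P,T):=\left|\frac1N|P\cap T|-\lambda^d(T)\right|$, where $|P\cap T|$ is the number of points of $P$ in $T$ counted with multiplicity and $\lambda^d$ is $d$-dimensional Lebesgue measure. For $y=(y_1,\ldots,y_d)\in[0,1]^d$ let $[0,y):=\prod_{j=1}^d[0,y_j)$. The star discrepancy of $P$ is $D^*_N(P):=\sup_{y\in[0,1]^d}D_N(P,[0,y))$. Latin hypercube sample: a Latin hypercube sample $(X_n)_{n\in[N]}$ in $[0,1)^d$ is the random $N$-point set whose coordinates are $$X_{n,j}=\frac{\pi_j(n)-u_{n,j}}{N},\qquad n\in[N],\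 j\in[d],$$ where $X_{n,j}$ is the $j$th coordinate of $X_n$, each $\pi_j$ is a permutation of $[N]$ chosen uniformly at random, each $u_{n,j}$ is uniformly distributed on $[0,1)$, and the $d$ permutations $\pi_j$ and the $dN$ random variables $u_{n,j}$ are mutually independent. (The points lie in $[0,1)^d$ almost surely.) *)

theory Defs
  imports "HOL-Probability.Probability" "HOL-Combinatorics.Permutations"
begin

text \<open>A vector of \<open>\<real>\<^sup>d\<close> is a function in \<open>extensional {1..d}\<close>, so that \<open>d\<close> can be quantified over.
  The completion makes \<open>lebesgue_dim d\<close> Lebesgue rather than Borel measure.\<close>

definition lebesgue_dim :: "nat \<Rightarrow> (nat \<Rightarrow> real) measure" where
  "lebesgue_dim d = completion (\<Pi>\<^sub>M j\<in>{1..d}. lborel)"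

definition anchored_box :: "nat \<Rightarrow> (nat \<Rightarrow> real) \<Rightarrow> (nat \<Rightarrow> real) set" where
  "anchored_box d y = (\<Pi>\<^sub>E j\<in>{1..d}. {0..<y j})"

definition local_discrepancy :: "nat \<Rightarrow> (nat \<Rightarrow> real) multiset \<Rightarrow> (nat \<Rightarrow> real) set \<Rightarrow> real" where
  "local_discrepancy d P T =
     \<bar>real (size {#x \<in># P. x \<in> T#}) / real (size P) - measure (lebesgue_dim d) T\<bar>"

definition star_discrepancy :: "nat \<Rightarrow> (nat \<Rightarrow> real) multiset \<Rightarrow> real" where
  "star_discrepancy d P =
     (SUP y \<in> (\<Pi>\<^sub>E j\<in>{1..d}. {0..1}). local_discrepancy d P (anchored_box d y))"

text \<open>The joint law of the permutations \<open>\<pi> j\<close> and the offsets \<open>u (n, j)\<close>. Expectations and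
  probabilities of functions of these variables depend only on this law, so it serves as the
  sample space; a free type variable for the sample space would allow constants quantified
  inside a formula to depend on it.\<close>

definition lhs_space :: "nat \<Rightarrow> nat \<Rightarrow> ((nat \<Rightarrow> nat \<Rightarrow> nat) \<times> (nat \<times> nat \<Rightarrow> real)) measure" where
  "lhs_space d N =
     (\<Pi>\<^sub>M j\<in>{1..d}. measure_pmf (pmf_of_set {p. p permutes {1..N}})) \<Otimes>\<^sub>M
     (\<Pi>\<^sub>M nj\<in>{1..N} \<times> {1..d}. uniform_measure lborel {0..<1})"

definition latin_hypercube_sample ::
    "nat \<Rightarrow> nat \<Rightarrow> (nat \<Rightarrow> nat \<Rightarrow> nat) \<times> (nat \<times> nat \<Rightarrow> real) \<Rightarrow> (nat \<Rightarrow> real) multiset" where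
  "latin_hypercube_sample d N = (\<lambda>(\<pi>, u).
     {#(\<lambda>j\<in>{1..d}. (real (\<pi> j n) - u (n, j)) / real N). n \<in># mset_set {1..N}#})"

lemma prob_space_lhs_space: "prob_space (lhs_space d N)"
  unfolding lhs_space_def
  by (intro prob_space_pair prob_space_PiM measure_pmf.prob_space_axioms
        prob_space_uniform_measure) auto

lemma size_latin_hypercube_sample: "size (latin_hypercube_sample d N \<omega>) = N"
  by (simp add: latin_hypercube_sample_def split: prod.split)

lemma measure_anchored_box:
  assumes "\<And>j. j \<in> {1..d} \<Longrightarrow> 0 \<le> y j"
  shows "measure (lebesgue_dim d) (anchored_box d y) = (\<Prod>j\<in>{1..d}. y j)"
proof -
  interpret product_sigma_finite "\<lambda>_::nat. lborel :: real measure"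
    by standard
  have "emeasure (\<Pi>\<^sub>M j\<in>{1..d}. lborel) (anchored_box d y) = (\<Prod>j\<in>{1..d}. ennreal (y j))"
    unfolding anchored_box_def using assms by (subst emeasure_PiM) (auto intro!: prod.cong)
  also have "\<dots> = ennreal (\<Prod>j\<in>{1..d}. y j)"
    using assms by (intro prod_ennreal) auto
  finally have "measure (\<Pi>\<^sub>M j\<in>{1..d}. lborel) (anchored_box d y) = (\<Prod>j\<in>{1..d}. y j)"
    unfolding measure_def using assms by (metis enn2real_ennreal prod_nonneg)
  moreover have "anchored_box d y \<in> sets (\<Pi>\<^sub>M j\<in>{1..d}. lborel)"
    unfolding anchored_box_def by (intro sets_PiM_I_finite) auto
  ultimately show ?thesis
    unfolding lebesgue_dim_def by simp
qed

end

theory Submission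
  imports Defs
begin

text \<open>
  The lower bound is witnessed by one random box, built greedily coordinate by coordinate. Its first
  side is half of the unit interval up to rounding. A Latin
  hypercube sample almost surely has \<open>N div 2\<close> points there, so the discrepancy is zero at this stage. In every
  further coordinate the side has length \<open>1\<close> or \<open>1 - k / N\<close> with \<open>k\<close> of order \<open>N / d\<close>. Let \<open>B\<close> be
  the set of points that survive the earlier coordinates. As the next permutation is independent of
  \<open>B\<close>, the number of points of \<open>B\<close> in the top slab of width \<open>k / N\<close> is hypergeometric with
  mean \<open>k * card B / N\<close> and standard deviation of order \<open>sqrt k\<close>. If the count exceeds the mean by
  a fixed multiple of \<open>sqrt k\<close> (a \<^emph>\<open>hit\<close>), the slab is cut off; otherwise the coordinate is left
  alone. A hit removes more points than volume, so it raises the deficit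
  \<open>N * volume - number of points\<close> by order \<open>sqrt k\<close>. Later cuts shrink a deficit only by the
  factors \<open>1 - k / N\<close>, whose product stays above \<open>1 / 2\<close>. With a positive fraction of
  the \<open>d - 1\<close> coordinates being hits the deficit reaches order \<open>d * sqrt (N / d) = sqrt (d * N)\<close>,
  which is a discrepancy of order \<open>sqrt (d / N)\<close>.

  Two probabilistic facts make this work. The first is that a hit has probability bounded below,
  uniformly in \<open>B\<close> as long as \<open>card B\<close> lies between \<open>N / 4\<close> and \<open>N / 2\<close> (lemma
  \<open>perm_avg_hit_ge\<close>); the cuts are thin enough to keep \<open>B\<close> in this range. It is an
  anti-concentration statement, obtained from moments. Reflecting the cells \<open>v \<mapsto> N + 1 - v\<close>
  pairs the top slab with the bottom slab. The difference of the two counts is a sum of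
  \<open>{-1, 0, 1}\<close>-valued variables, one for each pair of cells, and swapping the two cells of one pair
  changes one sign and preserves the uniform law. Such a sum has its second moment of order \<open>k\<close> and
  its fourth moment of order \<open>k ^ 2\<close>, hence its first absolute moment is of order \<open>sqrt k\<close>. By the
  triangle inequality so is that of the centred count, and a centred variable with a
  large first absolute moment and a bounded variance exceeds a multiple of \<open>sqrt k\<close> with positive
  probability.

  The second fact is a Chernoff bound for adaptively chosen events (lemmas
  \<open>sum_exp_neg_hits_le\<close> and \<open>card_few_hits_le\<close>): whatever the history, each coordinate multiplies
  the mean of \<open>exp (- hits)\<close> by a constant below \<open>1\<close>. So the probability of few hits decays
  exponentially in \<open>d\<close>. It can be computed by counting tuples of permutations, because the offsets
  enter only through the fact that a point inside the greedy box must belong to \<open>B\<close>.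

  The bound on the expectation follows from the tail bound, once the star discrepancy is known to
  be a measurable function on the sample space. This holds because rational boxes suffice for the
  supremum (lemma \<open>star_discrepancy_eq_rational_SUP\<close>).
\<close>

section \<open>Averages over all permutations of a finite set\<close>

definition perm_avg :: "'a set \<Rightarrow> (('a \<Rightarrow> 'a) \<Rightarrow> real) \<Rightarrow> real" where
  "perm_avg U f = (\<Sum>p | p permutes U. f p) / fact (card U)"

lemma perm_avg_add: "perm_avg U (\<lambda>p. f p + g p) = perm_avg U f + perm_avg U g"
  by (simp add: perm_avg_def sum.distrib add_divide_distrib)

lemma perm_avg_diff: "perm_avg U (\<lambda>p. f p - g p) = perm_avg U f - perm_avg U g"
  by (simp add: perm_avg_def sum_subtractf diff_divide_distrib)

lemma perm_avg_cmult: "perm_avg U (\<lambda>p. c * f p) = c * perm_avg U f"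
  by (simp add: perm_avg_def sum_distrib_left)

lemma perm_avg_uminus: "perm_avg U (\<lambda>p. - f p) = - perm_avg U f"
  using perm_avg_cmult[of U "-1" f] by simp

lemma perm_avg_sum: "perm_avg U (\<lambda>p. \<Sum>x\<in>A. f x p) = (\<Sum>x\<in>A. perm_avg U (f x))"
  unfolding perm_avg_def by (subst sum.swap) (simp add: sum_divide_distrib)

lemma perm_avg_const: "finite U \<Longrightarrow> perm_avg U (\<lambda>p. c) = c"
  by (simp add: perm_avg_def card_permutations)

lemma perm_avg_mono:
  "(\<And>p. p permutes U \<Longrightarrow> f p \<le> g p) \<Longrightarrow> perm_avg U f \<le> perm_avg U g"
  unfolding perm_avg_def by (intro divide_right_mono sum_mono) auto

lemma perm_avg_cong:
  "(\<And>p. p permutes U \<Longrightarrow> f p = g p) \<Longrightarrow> perm_avg U f = perm_avg U g"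
  unfolding perm_avg_def by (auto intro!: sum.cong)

lemma perm_avg_compose:
  assumes "q permutes U"
  shows "perm_avg U (\<lambda>p. f (q \<circ> p)) = perm_avg U f"
  unfolding perm_avg_def by (subst setum_permutations_compose_left[OF assms]) simp

section \<open>Moments of the number of selected cells in a random placement\<close>

text \<open>A permutation \<open>p\<close> puts point \<open>n\<close> into cell \<open>p n\<close>; the value is \<open>1\<close> if the point in cell \<open>v\<close>
  belongs to \<open>B\<close> and \<open>0\<close> otherwise. The whole section depends on \<open>p\<close> only through the random
  set \<open>p ` B\<close> of occupied cells.\<close>

definition occ :: "'a set \<Rightarrow> ('a \<Rightarrow> 'a) \<Rightarrow> 'a \<Rightarrow> real" where
  "occ B p v = indicator (p ` B) v"

lemma occ_compose_transpose: "occ B (Transposition.transpose a b \<circ> p) v = occ B p (Transposition.transpose a b v)"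
  unfolding occ_def image_comp[symmetric]
  by (auto simp: indicator_def in_transpose_image_iff)

lemma occ_sq: "occ B p v * occ B p v = occ B p v"
  by (simp add: occ_def indicator_def)

lemma sum_occ:
  assumes "finite U" "B \<subseteq> U" "p permutes U"
  shows "(\<Sum>v\<in>U. occ B p v) = real (card B)"
proof -
  have "p ` B \<subseteq> U" using assms permutes_image by blast
  moreover have "card (p ` B) = card B"
    using permutes_inj[OF assms(3)] by (meson card_image inj_on_subset subset_UNIV)
  ultimately show ?thesis
    unfolding occ_def using assms(1)
    by (simp add: indicator_def sum.If_cases Int_absorb1)
qed

lemma sum_occ_eq_card:
  assumes "finite A" "p permutes U"
  shows "(\<Sum>v\<in>A. occ B p v) = real (card {n\<in>B. p n \<in> A})"
proof -
  have "p ` B \<inter> A = p ` {n\<in>B. p n \<in> A}" by auto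
  moreover have "card (p ` {n\<in>B. p n \<in> A}) = card {n\<in>B. p n \<in> A}"
    using permutes_inj[OF assms(2)] by (meson card_image inj_on_subset subset_UNIV)
  ultimately show ?thesis
    unfolding occ_def using assms(1)
    by (simp add: indicator_def sum.If_cases) (metis Int_commute Collect_mem_eq)
qed

text \<open>The map \<open>\<rho>\<close> pairs each cell \<open>a\<close> of a set \<open>A\<close> with a partner outside \<open>A\<close>.\<close>

definition pair_diff :: "'a set \<Rightarrow> ('a \<Rightarrow> 'a) \<Rightarrow> ('a \<Rightarrow> 'a) \<Rightarrow> 'a \<Rightarrow> real" where
  "pair_diff B \<rho> p a = occ B p a - occ B p (\<rho> a)"

lemma pair_diff_cube: "pair_diff B \<rho> p a ^ 3 = pair_diff B \<rho> p a"
  by (simp add: pair_diff_def occ_def indicator_def)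

lemma pair_diff_sq_le: "pair_diff B \<rho> p a ^ 2 \<le> 1"
  by (simp add: pair_diff_def occ_def indicator_def)

lemma pair_diff_fourth_le: "pair_diff B \<rho> p a ^ 4 \<le> 1"
  by (simp add: pair_diff_def occ_def indicator_def)

context
  fixes U B :: "'a set"
  assumes fin: "finite U" and sub: "B \<subseteq> U"
begin

lemma perm_avg_occ:
  assumes v: "v \<in> U"
  shows "perm_avg U (\<lambda>p. occ B p v) = card B / card U"
proof -
  have sym: "perm_avg U (\<lambda>p. occ B p w) = perm_avg U (\<lambda>p. occ B p v)" if "w \<in> U" for w
    using perm_avg_compose[OF permutes_swap_id[OF v that], of "\<lambda>p. occ B p v"]
    by (simp add: occ_compose_transpose)
  have "real (card U) * perm_avg U (\<lambda>p. occ B p v) = (\<Sum>w\<in>U. perm_avg U (\<lambda>p. occ B p w))"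
    by (simp add: sym)
  also have "\<dots> = perm_avg U (\<lambda>p. \<Sum>w\<in>U. occ B p w)" by (simp add: perm_avg_sum)
  also have "\<dots> = perm_avg U (\<lambda>p. real (card B))"
    by (intro perm_avg_cong) (use sum_occ fin sub in auto)
  also have "\<dots> = card B" by (simp add: perm_avg_const fin)
  finally have "real (card U) * perm_avg U (\<lambda>p. occ B p v) = card B" .
  moreover have "card U \<noteq> 0" using v fin by auto
  ultimately show ?thesis by (simp add: field_simps)
qed

text \<open>By symmetry the joint moment is the same for every second cell \<open>w \<noteq> v\<close>. Summing over all of
  these collects the remaining \<open>card B - 1\<close> points whenever cell \<open>v\<close> is occupied.\<close>

lemma perm_avg_occ_occ:
  assumes v: "v \<in> U" "w \<in> U" "v \<noteq> w"
  shows "perm_avg U (\<lambda>p. occ B p v * occ B p w) =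
    real (card B) * (real (card B) - 1) / (real (card U) * (real (card U) - 1))"
proof -
  define r where "r = perm_avg U (\<lambda>p. occ B p v * occ B p w)"
  have sym: "perm_avg U (\<lambda>p. occ B p v * occ B p x) = r" if "x \<in> U - {v}" for x
  proof -
    have "perm_avg U (\<lambda>p. occ B (Transposition.transpose w x \<circ> p) v * occ B (Transposition.transpose w x \<circ> p) w) = r"
      using perm_avg_compose[OF permutes_swap_id[of w U x], of "\<lambda>p. occ B p v * occ B p w"] v that
      by (simp add: r_def)
    moreover have "Transposition.transpose w x v = v"
      using v that by (intro transpose_apply_other) auto
    ultimately show ?thesis by (simp add: occ_compose_transpose)
  qed
  have c2: "card U \<ge> 2"
    using card_mono[of U "{v,w}"] v fin by simp
  have "(real (card U) - 1) * r = (\<Sum>x\<in>U-{v}. perm_avg U (\<lambda>p. occ B p v * occ B p x))"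
    using v fin c2 by (simp add: sym of_nat_diff)
  also have "\<dots> = perm_avg U (\<lambda>p. occ B p v * (\<Sum>x\<in>U-{v}. occ B p x))"
    by (simp add: perm_avg_sum[symmetric] sum_distrib_left)
  also have "\<dots> = perm_avg U (\<lambda>p. (real (card B) - 1) * occ B p v)"
  proof (rule perm_avg_cong)
    fix p assume p: "p permutes U"
    have "(\<Sum>x\<in>U-{v}. occ B p x) = card B - occ B p v"
      using sum_occ[OF fin sub p] fin v by (simp add: sum_diff1)
    thus "occ B p v * (\<Sum>x\<in>U-{v}. occ B p x) = (real (card B) - 1) * occ B p v"
      by (simp only: right_diff_distrib left_diff_distrib occ_sq mult.commute[of "occ B p v" "real (card B)"] mult_1)
  qed
  also have "\<dots> = (real (card B) - 1) * (card B / card U)"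
    by (simp add: perm_avg_cmult perm_avg_occ v)
  finally have "(real (card U) - 1) * r = (real (card B) - 1) * (card B / card U)" .
  thus ?thesis using c2 unfolding r_def[symmetric]
    by (simp add: field_simps)
qed

lemma perm_avg_sum_occ:
  assumes "A \<subseteq> U"
  shows "perm_avg U (\<lambda>p. \<Sum>v\<in>A. occ B p v) = real (card A) * card B / card U"
proof -
  have "perm_avg U (\<lambda>p. \<Sum>v\<in>A. occ B p v) = (\<Sum>v\<in>A. card B / card U)"
    unfolding perm_avg_sum using assms by (intro sum.cong) (auto simp: perm_avg_occ)
  thus ?thesis by simp
qed

text \<open>Occupancies of different cells are negatively correlated.\<close>

lemma perm_avg_occ_occ_le:
  assumes v: "v \<in> U" "w \<in> U" "v \<noteq> w"
  shows "perm_avg U (\<lambda>p. occ B p v * occ B p w) \<le> (real (card B) / card U)\<^sup>2"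
proof -
  have c2: "card U \<ge> 2"
    using card_mono[of U "{v,w}"] v fin by simp
  have le: "real (card B) \<le> card U" using card_mono fin sub by auto
  have "(real (card B) - 1) / (real (card U) - 1) \<le> real (card B) / card U"
    using c2 le by (simp add: field_simps)
  hence "real (card B) / card U * ((real (card B) - 1) / (real (card U) - 1)) \<le>
    real (card B) / card U * (real (card B) / card U)"
    by (intro mult_left_mono) auto
  thus ?thesis unfolding perm_avg_occ_occ[OF v] by (simp add: power2_eq_square)
qed

text \<open>Expanding the square, the off-diagonal terms are covariances, which are not positive by
  the preceding lemma, and each of the \<open>card A\<close> diagonal terms is the variance of a
  \<open>{0, 1}\<close>-valued variable.\<close>

lemma perm_avg_variance_le:
  assumes A: "A \<subseteq> U"
  shows "perm_avg U (\<lambda>p. ((\<Sum>v\<in>A. occ B p v) - real (card A) * card B / card U)\<^sup>2) \<le> card A"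
proof -
  define t where "t = real (card B) / card U"
  have finA: "finite A" using A fin finite_subset by auto
  have t: "0 \<le> t" "t \<le> 1"
    using card_mono[OF fin sub] by (auto simp: t_def divide_le_eq_1)
  have "perm_avg U (\<lambda>p. ((\<Sum>v\<in>A. occ B p v) - real (card A) * card B / card U)\<^sup>2)
     = perm_avg U (\<lambda>p. (\<Sum>v\<in>A. \<Sum>w\<in>A. (occ B p v - t) * (occ B p w - t)))"
    by (intro perm_avg_cong)
       (simp add: power2_eq_square sum_product[symmetric] sum_subtractf t_def)
  also have "\<dots> = (\<Sum>v\<in>A. \<Sum>w\<in>A. perm_avg U (\<lambda>p. (occ B p v - t) * (occ B p w - t)))"
    by (simp add: perm_avg_sum)
  also have "\<dots> \<le> (\<Sum>v\<in>A. \<Sum>w\<in>A. if w = v then 1 else 0)"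
  proof (intro sum_mono)
    fix v w assume vw: "v \<in> A" "w \<in> A"
    have "perm_avg U (\<lambda>p. (occ B p v - t) * (occ B p w - t)) =
      perm_avg U (\<lambda>p. occ B p v * occ B p w - t * occ B p v - t * occ B p w + t * t)"
      by (intro perm_avg_cong) (simp add: algebra_simps)
    also have "\<dots> = perm_avg U (\<lambda>p. occ B p v * occ B p w) - t\<^sup>2"
      using vw A by (simp add: perm_avg_add perm_avg_diff perm_avg_cmult perm_avg_const fin
          perm_avg_occ subset_iff power2_eq_square flip: t_def)
    also have "\<dots> \<le> (if w = v then 1 else 0)"
    proof (cases "w = v")
      case True
      hence "perm_avg U (\<lambda>p. occ B p v * occ B p w) = t"
        using vw A by (auto simp: occ_sq perm_avg_occ t_def)
      moreover have "t - t\<^sup>2 \<le> 1" using t zero_le_power2[of t] by linarith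
      ultimately show ?thesis using True by simp
    next
      case False
      thus ?thesis using perm_avg_occ_occ_le[of v w] vw A by (auto simp: t_def)
    qed
    finally show "perm_avg U (\<lambda>p. (occ B p v - t) * (occ B p w - t)) \<le> (if w = v then 1 else 0)" .
  qed
  also have "\<dots> = card A" using finA by simp
  finally show ?thesis .
qed

context
  fixes A :: "'a set" and \<rho> :: "'a \<Rightarrow> 'a"
  assumes A: "A \<subseteq> U" and inj: "inj_on \<rho> A" and img: "\<rho> ` A \<subseteq> U" and disj: "A \<inter> \<rho> ` A = {}"
begin

text \<open>Swapping the cells \<open>a\<close> and \<open>\<rho> a\<close> after \<open>p\<close> changes the sign of the last factor and leaves all
  other pairs untouched, so the average equals its own negative.\<close>

lemma perm_avg_odd:
  fixes g :: "real \<Rightarrow> real"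
  assumes F: "F \<subseteq> A" and a: "a \<in> A" "a \<notin> F"
  shows "perm_avg U (\<lambda>p. g (\<Sum>x\<in>F. pair_diff B \<rho> p x) * pair_diff B \<rho> p a) = 0"
proof -
  define \<tau> where "\<tau> = Transposition.transpose a (\<rho> a)"
  have tp: "\<tau> permutes U" unfolding \<tau>_def using a A img by (intro permutes_swap_id) auto
  have other: "pair_diff B \<rho> (\<tau> \<circ> p) x = pair_diff B \<rho> p x" if "x \<in> F" for x p
  proof -
    have "x \<noteq> a" "x \<noteq> \<rho> a" "\<rho> x \<noteq> a" "\<rho> x \<noteq> \<rho> a"
      using that F a disj inj by (auto dest: inj_onD)
    thus ?thesis by (simp add: pair_diff_def \<tau>_def occ_compose_transpose)
  qed
  have flip: "pair_diff B \<rho> (\<tau> \<circ> p) a = - pair_diff B \<rho> p a" for p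
    by (simp add: pair_diff_def \<tau>_def occ_compose_transpose)
  have "perm_avg U (\<lambda>p. g (\<Sum>x\<in>F. pair_diff B \<rho> p x) * pair_diff B \<rho> p a) =
        perm_avg U (\<lambda>p. g (\<Sum>x\<in>F. pair_diff B \<rho> (\<tau> \<circ> p) x) * pair_diff B \<rho> (\<tau> \<circ> p) a)"
    by (rule perm_avg_compose[OF tp, symmetric])
  also have "\<dots> = - perm_avg U (\<lambda>p. g (\<Sum>x\<in>F. pair_diff B \<rho> p x) * pair_diff B \<rho> p a)"
    by (simp add: other flip perm_avg_uminus cong: sum.cong)
  finally show ?thesis by simp
qed

lemma perm_avg_pair_diff_sq:
  assumes a: "a \<in> A"
  shows "perm_avg U (\<lambda>p. pair_diff B \<rho> p a ^ 2) =
    2 * real (card B) * (real (card U) - card B) / (real (card U) * (real (card U) - 1))"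
proof -
  have m: "a \<in> U" "\<rho> a \<in> U" "a \<noteq> \<rho> a" using a A img disj by auto
  have c2: "card U \<ge> 2"
    using card_mono[of U "{a, \<rho> a}"] m fin by simp
  have "perm_avg U (\<lambda>p. pair_diff B \<rho> p a ^ 2) =
    perm_avg U (\<lambda>p. occ B p a + occ B p (\<rho> a) - 2 * (occ B p a * occ B p (\<rho> a)))"
    by (intro perm_avg_cong)
      (simp add: pair_diff_def power2_eq_square algebra_simps occ_sq)
  also have "\<dots> = 2 * (card B / card U) -
     2 * (real (card B) * (real (card B) - 1) / (real (card U) * (real (card U) - 1)))"
    by (simp add: perm_avg_add perm_avg_diff perm_avg_cmult perm_avg_occ perm_avg_occ_occ m)
  also have "\<dots> = 2 * real (card B) * (real (card U) - card B) / (real (card U) * (real (card U) - 1))"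
    using c2 by (simp add: divide_simps) (simp add: algebra_simps)
  finally show ?thesis .
qed

text \<open>The mixed terms are odd in one of the pairs.\<close>

lemma perm_avg_sum_pair_diff_sq:
  assumes "F \<subseteq> A"
  shows "perm_avg U (\<lambda>p. (\<Sum>x\<in>F. pair_diff B \<rho> p x)\<^sup>2) = (\<Sum>x\<in>F. perm_avg U (\<lambda>p. pair_diff B \<rho> p x ^ 2))"
proof -
  have "finite F" using assms A fin finite_subset by metis
  thus ?thesis using assms
  proof induction
    case empty
    show ?case by (simp add: perm_avg_const fin)
  next
    case (insert a F)
    have "perm_avg U (\<lambda>p. (\<Sum>x\<in>insert a F. pair_diff B \<rho> p x)\<^sup>2) =
      perm_avg U (\<lambda>p. pair_diff B \<rho> p a ^ 2 + (\<Sum>x\<in>F. pair_diff B \<rho> p x)\<^sup>2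
         + 2 * ((\<Sum>x\<in>F. pair_diff B \<rho> p x) * pair_diff B \<rho> p a))"
      using insert by (intro perm_avg_cong) (simp add: power2_eq_square algebra_simps)
    also have "\<dots> = perm_avg U (\<lambda>p. pair_diff B \<rho> p a ^ 2) + perm_avg U (\<lambda>p. (\<Sum>x\<in>F. pair_diff B \<rho> p x)\<^sup>2)"
      using insert perm_avg_odd[of F a "\<lambda>s. s"] by (simp add: perm_avg_add perm_avg_cmult)
    finally show ?case using insert by simp
  qed
qed

text \<open>The same bound as for a sum of independent signs. Adding one pair with difference \<open>x\<close> to a sum
  \<open>s\<close> only contributes \<open>6 * s\<^sup>2 * x\<^sup>2 + x ^ 4\<close> on average, because \<open>s ^ 3 * x\<close> and
  \<open>s * x ^ 3 = s * x\<close> are odd; and \<open>3 * n\<^sup>2 + 6 * n + 1 \<le> 3 * (n + 1)\<^sup>2\<close>.\<close>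

lemma perm_avg_sum_pair_diff_fourth:
  assumes "F \<subseteq> A"
  shows "perm_avg U (\<lambda>p. (\<Sum>x\<in>F. pair_diff B \<rho> p x) ^ 4) \<le> 3 * (real (card F))\<^sup>2"
proof -
  have "finite F" using assms A fin finite_subset by metis
  thus ?thesis using assms
  proof induction
    case empty
    show ?case by (simp add: perm_avg_const fin)
  next
    case (insert a F)
    define S where "S = (\<lambda>p. \<Sum>x\<in>F. pair_diff B \<rho> p x)"
    have odd: "perm_avg U (\<lambda>p. g (S p) * pair_diff B \<rho> p a) = 0" for g
      using perm_avg_odd[of F a g] insert by (simp add: S_def)
    have sq: "perm_avg U (\<lambda>p. S p ^ 2) \<le> card F"
    proof -
      have "perm_avg U (\<lambda>p. S p ^ 2) = (\<Sum>x\<in>F. perm_avg U (\<lambda>p. pair_diff B \<rho> p x ^ 2))"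
        unfolding S_def using perm_avg_sum_pair_diff_sq insert by simp
      also have "\<dots> \<le> (\<Sum>x\<in>F. perm_avg U (\<lambda>p. 1))"
        by (intro sum_mono perm_avg_mono pair_diff_sq_le)
      finally show ?thesis by (simp add: perm_avg_const fin)
    qed
    have "perm_avg U (\<lambda>p. (\<Sum>x\<in>insert a F. pair_diff B \<rho> p x) ^ 4) \<le>
      perm_avg U (\<lambda>p. S p ^ 4 + 6 * S p ^ 2 + 1
         + 4 * (S p ^ 3 * pair_diff B \<rho> p a) + 4 * (S p * pair_diff B \<rho> p a))"
    proof (rule perm_avg_mono)
      fix p
      define s x where "s = S p" and "x = pair_diff B \<rho> p a"
      have "(s + x) ^ 4 = s^4 + 6 * (s^2 * x^2) + x^4 + 4 * (s^3 * x) + 4 * (s * x^3)"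
        by (simp add: power4_eq_xxxx power3_eq_cube power2_eq_square algebra_simps)
      moreover have "x^3 = x" "x^4 \<le> 1" unfolding x_def by (fact pair_diff_cube pair_diff_fourth_le)+
      moreover have "s^2 * x^2 \<le> s^2 * 1"
        unfolding x_def by (intro mult_left_mono pair_diff_sq_le) auto
      ultimately have "(s + x) ^ 4 \<le> s^4 + 6 * s^2 + 1 + 4 * (s^3 * x) + 4 * (s * x)"
        by simp
      thus "(\<Sum>x\<in>insert a F. pair_diff B \<rho> p x) ^ 4 \<le> S p ^ 4 + 6 * S p ^ 2 + 1
         + 4 * (S p ^ 3 * pair_diff B \<rho> p a) + 4 * (S p * pair_diff B \<rho> p a)"
        using insert by (simp add: s_def x_def S_def add.commute)
    qed
    also have "\<dots> = perm_avg U (\<lambda>p. S p ^ 4) + 6 * perm_avg U (\<lambda>p. S p ^ 2) + 1"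
      using odd[of "\<lambda>s. s^3"] odd[of "\<lambda>s. s"]
      by (simp add: perm_avg_add perm_avg_cmult perm_avg_const fin)
    also have "\<dots> \<le> 3 * (real (card F))\<^sup>2 + 6 * card F + 1"
      using insert sq by (simp add: S_def)
    also have "\<dots> \<le> 3 * (real (card (insert a F)))\<^sup>2"
      using insert by (simp add: power2_eq_square algebra_simps)
    finally show ?case .
  qed
qed

end
end

section \<open>An overfull top slab has positive probability\<close>

definition hit :: "nat \<Rightarrow> nat \<Rightarrow> nat set \<Rightarrow> (nat \<Rightarrow> nat) \<Rightarrow> bool" where
  "hit N k B p \<longleftrightarrow>
     real (card {n\<in>B. N - k < p n}) \<ge> real k * real (card B) / real N + sqrt (real k) / 400"

text \<open>Integrating this bounds a first absolute moment from below by the second and the fourth moment;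
  the scale \<open>s\<close> should be a large enough multiple of the standard deviation.\<close>

lemma abs_ge_square_minus_fourth:
  fixes z s :: real
  assumes "s > 0"
  shows "z\<^sup>2 / s - z ^ 4 / s ^ 3 \<le> \<bar>z\<bar>"
proof -
  define t where "t = \<bar>z\<bar> / s"
  have t: "t \<ge> 0" "\<bar>z\<bar> = t * s" using assms by (auto simp: t_def)
  have "t - t ^ 3 \<le> 1"
  proof (cases "t \<le> 1")
    case True
    thus ?thesis using zero_le_power[OF t(1), of 3] by linarith
  next
    case False
    hence "t ^ 1 \<le> t ^ 3" by (intro power_increasing) auto
    thus ?thesis by simp
  qed
  hence "t * s * (t - t ^ 3) \<le> t * s * 1" using t assms by (intro mult_left_mono) auto
  moreover have "z\<^sup>2 = (t * s)\<^sup>2" "z ^ 4 = (t * s) ^ 4"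
    unfolding t(2)[symmetric] by (simp_all add: power_even_abs)
  ultimately show ?thesis using assms t
    by (simp add: power2_eq_square power3_eq_cube power4_eq_xxxx algebra_simps)
qed

text \<open>The bounds on \<open>card B\<close> keep the second moment of the paired difference at least \<open>k / 4\<close>. The rest
  is the moment argument for the centred count \<open>Y\<close>, whose first absolute moment is at least half
  of that of the difference of two equally distributed counts.\<close>

lemma perm_avg_hit_ge:
  fixes N k :: nat and B :: "nat set"
  assumes k: "0 < k" "2 * k \<le> N" and B: "B \<subseteq> {1..N}" "N \<le> 4 * card B" "2 * card B \<le> N"
  shows "perm_avg {1..N} (\<lambda>p. of_bool (hit N k B p)) \<ge> 1 / 80000"
proof -
  define U A where "U = {1..N}" and "A = {N-k<..N}"
  define \<rho> where "\<rho> = (\<lambda>v. N + 1 - v)"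
  have A: "A \<subseteq> U" "card A = k" "finite A" using k by (auto simp: A_def U_def)
  have inj: "inj_on \<rho> U" by (auto simp: \<rho>_def U_def inj_on_def)
  have \<rho>U: "\<rho> ` U = U"
    by (rule endo_inj_surj) (use inj in \<open>auto simp: \<rho>_def U_def\<close>)
  have \<rho>A: "\<rho> ` A \<subseteq> U" "inj_on \<rho> A" using \<rho>U inj A inj_on_subset by blast+
  have disj: "A \<inter> \<rho> ` A = {}" using k by (auto simp: A_def \<rho>_def)
  define \<mu> where "\<mu> = real k * card B / N"
  define X X' where "X = (\<lambda>p. \<Sum>v\<in>A. occ B p v)" and "X' = (\<lambda>p. \<Sum>v\<in>\<rho> ` A. occ B p v)"
  define Z where "Z = (\<lambda>p. X p - X' p)"
  define r where "r = sqrt (real k)"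
  have r: "r > 0" "r\<^sup>2 = k" using k by (auto simp: r_def)
  note hyps = finite_atLeastAtMost[of 1 N, folded U_def] B(1)[folded U_def]
  note hyps' = hyps A(1) \<rho>A(2) \<rho>A(1) disj
  have Z: "Z p = (\<Sum>a\<in>A. pair_diff B \<rho> p a)" for p
    unfolding Z_def X_def X'_def pair_diff_def using \<rho>A
    by (simp add: sum.reindex sum_subtractf)
  define q where "q = 2 * real (card B) * (real (card U) - card B) / (real (card U) * (real (card U) - 1))"
  have q: "q \<ge> 1/4"
  proof -
    have N: "real N \<ge> 2" using k by linarith
    have "real N / 4 \<le> card B" "real N / 2 \<le> real N - card B" using B by linarith+
    hence "real N / 4 * (real N / 2) \<le> card B * (real N - card B)"
      using N by (intro mult_mono) auto
    hence "real N * real N \<le> 8 * (card B * (real N - card B))" by simp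
    moreover have "real N * (real N - 1) \<le> real N * real N" using N by (intro mult_left_mono) auto
    ultimately show ?thesis using N unfolding q_def U_def
      by (simp add: field_simps)
  qed
  have Z2: "perm_avg U (\<lambda>p. Z p ^ 2) = k * q"
    using perm_avg_sum_pair_diff_sq[OF hyps' order_refl] perm_avg_pair_diff_sq[OF hyps']
    by (simp add: Z q_def A)
  have Z4: "perm_avg U (\<lambda>p. Z p ^ 4) \<le> 3 * r ^ 4"
  proof -
    have "r ^ 4 = (real k)\<^sup>2" by (simp flip: r(2))
    thus ?thesis
      using perm_avg_sum_pair_diff_fourth[OF hyps' order_refl] by (simp add: Z A)
  qed
  \<comment> \<open>The scale \<open>5 * r\<close> leaves \<open>r * (1/20 - 3/125)\<close>, a little more than \<open>r / 40\<close>.\<close>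
  have absZ: "perm_avg U (\<lambda>p. \<bar>Z p\<bar>) \<ge> r / 40"
  proof -
    have "r / 40 \<le> r * (1/20 - 3/125)" using r by simp
    also have "\<dots> = (1 / (5 * r)) * (r\<^sup>2 * (1/4)) - (1 / (5 * r) ^ 3) * (3 * r ^ 4)"
      using r by (simp add: field_simps power2_eq_square power3_eq_cube power4_eq_xxxx)
    also have "\<dots> \<le> (1 / (5 * r)) * perm_avg U (\<lambda>p. Z p ^ 2) - (1 / (5 * r) ^ 3) * perm_avg U (\<lambda>p. Z p ^ 4)"
    proof -
      have "r\<^sup>2 * (1/4) \<le> perm_avg U (\<lambda>p. Z p ^ 2)"
        unfolding Z2 r(2) using q by (intro mult_left_mono) auto
      thus ?thesis using r Z4 by (intro diff_mono mult_left_mono) auto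
    qed
    also have "\<dots> = perm_avg U (\<lambda>p. (1 / (5 * r)) * Z p ^ 2 - (1 / (5 * r) ^ 3) * Z p ^ 4)"
      by (simp only: perm_avg_diff perm_avg_cmult)
    also have "\<dots> \<le> perm_avg U (\<lambda>p. \<bar>Z p\<bar>)"
      using abs_ge_square_minus_fourth[of "5 * r"] r by (intro perm_avg_mono) simp
    finally show ?thesis .
  qed
  define Y where "Y = (\<lambda>p. X p - \<mu>)"
  \<comment> \<open>The reflection preserves the uniform law, so the bottom count \<open>X'\<close> is distributed like \<open>X\<close>.\<close>
  have absY: "perm_avg U (\<lambda>p. \<bar>Y p\<bar>) \<ge> r / 80"
  proof -
    define \<sigma> where "\<sigma> = (\<lambda>v. if v \<in> U then \<rho> v else v)"
    have \<sigma>: "\<sigma> permutes U"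
    proof (rule bij_imp_permutes)
      show "bij_betw \<sigma> U U"
        using inj \<rho>U by (subst bij_betw_cong[of _ _ \<rho>]) (auto simp: bij_betw_def \<sigma>_def)
    qed (auto simp: \<sigma>_def)
    have "X' (\<sigma> \<circ> p) = X p" for p
    proof -
      have "occ B (\<sigma> \<circ> p) (\<rho> v) = occ B p v" if "v \<in> A" for v
      proof -
        have "\<rho> v = \<sigma> v" using that A by (auto simp: \<sigma>_def)
        hence "\<rho> v \<in> (\<sigma> \<circ> p) ` B \<longleftrightarrow> v \<in> p ` B"
          using inj_image_mem_iff[OF permutes_inj[OF \<sigma>], of v "p ` B"] by (simp only: image_comp)
        thus ?thesis by (simp only: occ_def indicator_def)
      qed
      thus ?thesis unfolding X_def X'_def using \<rho>A by (simp add: sum.reindex)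
    qed
    hence "perm_avg U (\<lambda>p. \<bar>X' p - \<mu>\<bar>) = perm_avg U (\<lambda>p. \<bar>Y p\<bar>)"
      using perm_avg_compose[OF \<sigma>, of "\<lambda>p. \<bar>X' p - \<mu>\<bar>"] by (simp add: Y_def)
    moreover have "perm_avg U (\<lambda>p. \<bar>Z p\<bar>) \<le> perm_avg U (\<lambda>p. \<bar>Y p\<bar> + \<bar>X' p - \<mu>\<bar>)"
      by (intro perm_avg_mono) (auto simp: Z_def Y_def)
    ultimately show ?thesis using absZ by (simp add: perm_avg_add)
  qed
  have Y0: "perm_avg U Y = 0"
    using perm_avg_sum_occ[OF hyps A(1)] hyps
    by (simp add: Y_def X_def perm_avg_diff perm_avg_const \<mu>_def A) (simp add: U_def)
  have Y2: "perm_avg U (\<lambda>p. Y p ^ 2) \<le> r\<^sup>2"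
    using perm_avg_variance_le[OF hyps A(1)] by (simp add: Y_def X_def \<mu>_def A r U_def)
  define H where "H = (\<lambda>p. of_bool (hit N k B p) :: real)"
  have H: "H p = of_bool (Y p \<ge> r / 400)" if "p permutes U" for p
  proof -
    have "p n \<le> N" if "n \<in> B" for n
      using permutes_in_image[OF \<open>p permutes U\<close>, of n] that B(1) by (auto simp: U_def)
    hence "{n\<in>B. N - k < p n} = {n\<in>B. p n \<in> A}"
      by (auto simp: A_def)
    thus ?thesis using sum_occ_eq_card[OF A(3) that, of B]
      by (simp add: H_def hit_def Y_def X_def \<mu>_def r_def algebra_simps)
  qed
  \<comment> \<open>As \<open>Y\<close> has mean \<open>0\<close>, its positive part carries half of the first absolute moment. Off the
    event the positive part is small; on the event it is split by the arithmetic-geometric mean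
    inequality into a multiple of \<open>Y\<^sup>2\<close>, which has a bounded mean, and a constant.\<close>
  have "r / 80 \<le> perm_avg U (\<lambda>p. \<bar>Y p\<bar> + Y p)"
    using absY Y0 by (simp add: perm_avg_add)
  also have "\<dots> \<le> perm_avg U (\<lambda>p. r / 200 + (1 / (400 * r)) * Y p ^ 2 + 400 * r * H p)"
  proof (rule perm_avg_mono)
    fix p assume p: "p permutes U"
    define y where "y = Y p"
    have sq: "0 \<le> (1 / (400 * r)) * y\<^sup>2" using r by simp
    show "\<bar>Y p\<bar> + Y p \<le> r / 200 + (1 / (400 * r)) * Y p ^ 2 + 400 * r * H p"
    proof (cases "y \<ge> r / 400")
      case True
      have "0 \<le> (y - 400 * r)\<^sup>2 / (400 * r)" using r by simp
      also have "\<dots> = (1 / (400 * r)) * y\<^sup>2 + 400 * r - 2 * y"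
        using r by (simp add: field_simps power2_eq_square)
      finally show ?thesis using True r H[OF p] by (simp add: y_def)
    next
      case False
      have "\<bar>y\<bar> + y \<le> r / 200" using False r by linarith
      moreover have "400 * r * H p = 0" using False H[OF p] by (simp add: y_def)
      ultimately show ?thesis using sq unfolding y_def by linarith
    qed
  qed
  also have "\<dots> = r / 200 + (1 / (400 * r)) * perm_avg U (\<lambda>p. Y p ^ 2) + 400 * r * perm_avg U H"
    by (simp only: perm_avg_add perm_avg_cmult perm_avg_const[OF hyps(1)])
  also have "\<dots> \<le> r / 200 + (1 / (400 * r)) * r\<^sup>2 + 400 * r * perm_avg U H"
    using Y2 r by (intro add_mono mult_left_mono) auto
  also have "\<dots> = r * (1/200 + 1/400 + 400 * perm_avg U H)"
  proof -
    have "(1 / (400 * r)) * r\<^sup>2 = r / 400" using r(1) by (simp add: power2_eq_square)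
    thus ?thesis by (simp add: algebra_simps)
  qed
  finally have "r * (1/80) \<le> r * (1/200 + 1/400 + 400 * perm_avg U H)" by simp
  hence "1/80 \<le> 1/200 + 1/400 + 400 * perm_avg U H" using r by (simp only: mult_le_cancel_left_pos)
  thus ?thesis by (simp add: H_def U_def)
qed

section \<open>The greedy construction and its number of hits\<close>

text \<open>After \<open>i\<close> steps the coordinates \<open>1, \<dots>, Suc i\<close> have been treated: coordinate \<open>1\<close> is the
  initial halving, and step \<open>i\<close> decides about coordinate \<open>Suc (Suc i)\<close>. The construction only looks
  at the permutations, because up to the boundary of a cell they determine the position of a point.\<close>

primrec greedy_points :: "nat \<Rightarrow> nat \<Rightarrow> (nat \<Rightarrow> nat \<Rightarrow> nat) \<Rightarrow> nat \<Rightarrow> nat set" where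
  "greedy_points N k \<pi> 0 = {n\<in>{1..N}. \<pi> 1 n \<le> N div 2}"
| "greedy_points N k \<pi> (Suc i) =
    (let B = greedy_points N k \<pi> i
     in if hit N k B (\<pi> (Suc (Suc i))) then {n\<in>B. \<pi> (Suc (Suc i)) n \<le> N - k} else B)"

definition hit_step :: "nat \<Rightarrow> nat \<Rightarrow> (nat \<Rightarrow> nat \<Rightarrow> nat) \<Rightarrow> nat \<Rightarrow> bool" where
  "hit_step N k \<pi> i \<longleftrightarrow> hit N k (greedy_points N k \<pi> i) (\<pi> (Suc (Suc i)))"

definition hits :: "nat \<Rightarrow> nat \<Rightarrow> (nat \<Rightarrow> nat \<Rightarrow> nat) \<Rightarrow> nat \<Rightarrow> nat" where
  "hits N k \<pi> i = card {l. l < i \<and> hit_step N k \<pi> l}"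

lemma greedy_points_Suc:
  "greedy_points N k \<pi> (Suc i) =
    (if hit_step N k \<pi> i then {n\<in>greedy_points N k \<pi> i. \<pi> (Suc (Suc i)) n \<le> N - k}
     else greedy_points N k \<pi> i)"
  by (simp add: hit_step_def Let_def)

declare greedy_points.simps(2) [simp del]

lemma hits_0: "hits N k \<pi> 0 = 0"
  by (simp add: hits_def)

lemma hits_Suc: "hits N k \<pi> (Suc i) = hits N k \<pi> i + of_bool (hit_step N k \<pi> i)"
proof -
  have "{l. l < Suc i \<and> hit_step N k \<pi> l} =
    (if hit_step N k \<pi> i then insert i {l. l < i \<and> hit_step N k \<pi> l} else {l. l < i \<and> hit_step N k \<pi> l})"
    by (auto simp: less_Suc_eq)
  thus ?thesis by (simp add: hits_def)
qed

lemma greedy_points_cong: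
  "(\<And>j. j \<in> {1..Suc i} \<Longrightarrow> \<pi> j = \<pi>' j) \<Longrightarrow> greedy_points N k \<pi> i = greedy_points N k \<pi>' i"
proof (induction i)
  case (Suc i)
  have "greedy_points N k \<pi> i = greedy_points N k \<pi>' i" by (rule Suc.IH) (use Suc.prems in auto)
  moreover have "\<pi> (Suc (Suc i)) = \<pi>' (Suc (Suc i))" using Suc.prems by simp
  ultimately show ?case by (simp add: greedy_points_Suc hit_step_def)
qed simp

lemma hits_cong:
  "(\<And>j. j \<in> {1..Suc i} \<Longrightarrow> \<pi> j = \<pi>' j) \<Longrightarrow> hits N k \<pi> i = hits N k \<pi>' i"
proof (induction i)
  case (Suc i)
  have "hits N k \<pi> i = hits N k \<pi>' i" by (rule Suc.IH) (use Suc.prems in auto)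
  moreover have "greedy_points N k \<pi> i = greedy_points N k \<pi>' i"
    by (rule greedy_points_cong) (use Suc.prems in auto)
  moreover have "\<pi> (Suc (Suc i)) = \<pi>' (Suc (Suc i))" using Suc.prems by simp
  ultimately show ?case by (simp add: hits_Suc hit_step_def)
qed (simp add: hits_0)

definition perm_tuples :: "nat \<Rightarrow> nat \<Rightarrow> (nat \<Rightarrow> nat \<Rightarrow> nat) set" where
  "perm_tuples N d = (\<Pi>\<^sub>E j\<in>{1..d}. {p. p permutes {1..N}})"

lemma perm_tuplesD: "\<pi> \<in> perm_tuples N d \<Longrightarrow> j \<in> {1..d} \<Longrightarrow> \<pi> j permutes {1..N}"
  by (auto simp: perm_tuples_def PiE_iff)

lemma finite_perm_tuples: "finite (perm_tuples N d)"
  unfolding perm_tuples_def by (intro finite_PiE) (auto intro: finite_permutations)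

lemma card_perm_tuples: "card (perm_tuples N d) = fact N ^ d"
  unfolding perm_tuples_def by (subst card_PiE) (auto simp: card_permutations)

lemma greedy_points_subset: "greedy_points N k \<pi> i \<subseteq> {1..N}"
  by (induction i) (auto simp: greedy_points_Suc)

lemma finite_greedy_points: "finite (greedy_points N k \<pi> i)"
  by (rule finite_subset[OF greedy_points_subset]) simp

lemma card_greedy_points_0:
  assumes "\<pi> 1 permutes {1..N}"
  shows "card (greedy_points N k \<pi> 0) = N div 2"
proof -
  have "\<pi> 1 ` greedy_points N k \<pi> 0 = {1..N div 2}"
  proof (intro equalityI subsetI)
    fix v assume v: "v \<in> {1..N div 2}"
    hence "v \<in> \<pi> 1 ` {1..N}" using permutes_image[OF assms] by auto
    thus "v \<in> \<pi> 1 ` greedy_points N k \<pi> 0" using v by auto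
  qed (use permutes_in_image[OF assms] in auto)
  moreover have "inj_on (\<pi> 1) (greedy_points N k \<pi> 0)"
    by (rule inj_on_subset[OF permutes_inj[OF assms]]) simp
  ultimately show ?thesis using card_image by fastforce
qed

lemma card_top_slab_le:
  assumes "p permutes {1..N}" "B \<subseteq> {1..N}"
  shows "card {n\<in>B. N - k < p n} \<le> k"
proof -
  have "p ` {n\<in>B. N - k < p n} \<subseteq> {N-k<..N}"
  proof safe
    fix n assume "n \<in> B" "N - k < p n"
    thus "p n \<in> {N-k<..N}" using permutes_in_image[OF assms(1), of n] assms(2) by auto
  qed
  hence "card (p ` {n\<in>B. N - k < p n}) \<le> card {N-k<..N}" by (intro card_mono) auto
  moreover have "card (p ` {n\<in>B. N - k < p n}) = card {n\<in>B. N - k < p n}"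
    by (intro card_image inj_on_subset[OF permutes_inj[OF assms(1)]]) simp
  ultimately show ?thesis by simp
qed

lemma card_split_slab:
  fixes p :: "nat \<Rightarrow> nat"
  assumes "finite B"
  shows "card B = card {n\<in>B. p n \<le> m} + card {n\<in>B. m < p n}"
proof -
  have "card ({n\<in>B. p n \<le> m} \<union> {n\<in>B. m < p n}) = card {n\<in>B. p n \<le> m} + card {n\<in>B. m < p n}"
    using assms by (intro card_Un_disjoint) auto
  moreover have "{n\<in>B. p n \<le> m} \<union> {n\<in>B. m < p n} = B" by auto
  ultimately show ?thesis by simp
qed

lemma card_greedy_points_le:
  assumes "\<pi> 1 permutes {1..N}"
  shows "card (greedy_points N k \<pi> i) \<le> N div 2"
proof (induction i)
  case (Suc i)
  have "card (greedy_points N k \<pi> (Suc i)) \<le> card (greedy_points N k \<pi> i)"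
    by (intro card_mono finite_greedy_points) (auto simp: greedy_points_Suc)
  thus ?case using Suc by simp
qed (use card_greedy_points_0[of \<pi> N k] assms in simp)

text \<open>A cut removes at most \<open>k\<close> points, since the top slab consists of \<open>k\<close> cells. This crude count
  already keeps the set of survivors as large as lemma \<open>perm_avg_hit_ge\<close> requires.\<close>

lemma card_greedy_points_ge:
  assumes "\<And>j. j \<in> {1..Suc i} \<Longrightarrow> \<pi> j permutes {1..N}"
  shows "N div 2 \<le> card (greedy_points N k \<pi> i) + i * k"
  using assms
proof (induction i)
  case (Suc i)
  have "N div 2 \<le> card (greedy_points N k \<pi> i) + i * k" by (rule Suc.IH) (use Suc.prems in auto)
  moreover have "card (greedy_points N k \<pi> i) \<le> card (greedy_points N k \<pi> (Suc i)) + k"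
  proof -
    define B p where "B = greedy_points N k \<pi> i" and "p = \<pi> (Suc (Suc i))"
    have "p permutes {1..N}" unfolding p_def by (rule Suc.prems) simp
    hence "card {n\<in>B. N - k < p n} \<le> k"
      by (rule card_top_slab_le) (simp only: B_def greedy_points_subset)
    moreover have "card B = card {n\<in>B. p n \<le> N - k} + card {n\<in>B. N - k < p n}"
      by (rule card_split_slab) (simp only: B_def finite_greedy_points)
    ultimately show ?thesis
      unfolding greedy_points_Suc B_def[symmetric] p_def[symmetric] by (cases "hit_step N k \<pi> i") simp_all
  qed
  ultimately show ?case by simp
qed (use card_greedy_points_0[of \<pi> N k] in simp)

lemma sum_perm_tuples_Suc:
  "(\<Sum>\<pi>\<in>perm_tuples N (Suc d). f \<pi>) =
   (\<Sum>\<pi>\<in>perm_tuples N d. \<Sum>p | p permutes {1..N}. f (\<pi>(Suc d := p)))"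
proof -
  define P where "P = {p. p permutes {1..N}}"
  have inj: "inj_on (\<lambda>(y, g). g(Suc d := y)) (P \<times> perm_tuples N d)"
    unfolding perm_tuples_def P_def by (rule inj_combinator) simp
  have ins: "{1..Suc d} = insert (Suc d) {1..d}" by auto
  have "perm_tuples N (Suc d) = (\<lambda>(y, g). g(Suc d := y)) ` (P \<times> perm_tuples N d)"
    unfolding perm_tuples_def ins PiE_insert_eq by (simp add: P_def)
  hence "(\<Sum>\<pi>\<in>perm_tuples N (Suc d). f \<pi>) = (\<Sum>(p, \<pi>)\<in>P \<times> perm_tuples N d. f (\<pi>(Suc d := p)))"
    using inj by (simp add: sum.reindex case_prod_beta' o_def)
  also have "\<dots> = (\<Sum>\<pi>\<in>perm_tuples N d. \<Sum>p\<in>P. f (\<pi>(Suc d := p)))"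
    by (subst sum.swap) (simp add: sum.cartesian_product)
  finally show ?thesis by (simp add: P_def)
qed

text \<open>The set of survivors depends on the earlier permutations only. Hence, with these fixed, the
  average over the last permutation gains the factor
  \<open>1 - (1 - exp (-1)) * P(hit) \<le> 1 - 1 / 160000\<close>.\<close>

lemma sum_exp_neg_hits_le:
  assumes N: "4 \<le> N" and k: "0 < k" "8 * (i * k) \<le> N" "8 * k \<le> N"
  shows "(\<Sum>\<pi>\<in>perm_tuples N (Suc i). exp (- real (hits N k \<pi> i))) \<le> fact N ^ Suc i * exp (- real i / 160000)"
  using k(2)
proof (induction i)
  case 0
  show ?case by (simp add: hits_0 card_perm_tuples del: power_Suc)
next
  case (Suc i)
  define P where "P = {p. p permutes {1..N}}"
  have "(\<Sum>\<pi>\<in>perm_tuples N (Suc (Suc i)). exp (- real (hits N k \<pi> (Suc i)))) =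
    (\<Sum>\<pi>\<in>perm_tuples N (Suc i). \<Sum>p\<in>P. exp (- real (hits N k (\<pi>(Suc (Suc i) := p)) (Suc i))))"
    unfolding P_def by (rule sum_perm_tuples_Suc)
  also have "\<dots> \<le> (\<Sum>\<pi>\<in>perm_tuples N (Suc i). exp (- real (hits N k \<pi> i)) * (fact N * exp (- 1 / 160000)))"
  proof (rule sum_mono)
    fix \<pi> assume \<pi>: "\<pi> \<in> perm_tuples N (Suc i)"
    define B where "B = greedy_points N k \<pi> i"
    have perm: "\<pi> j permutes {1..N}" if "j \<in> {1..Suc i}" for j
      using perm_tuplesD[OF \<pi> that] .
    have B: "B \<subseteq> {1..N}" "2 * card B \<le> N" "N \<le> 4 * card B"
    proof -
      show "B \<subseteq> {1..N}" unfolding B_def by (rule greedy_points_subset)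
      show "2 * card B \<le> N" using card_greedy_points_le[of \<pi> N k i] perm[of 1] by (simp add: B_def)
      have "N div 2 \<le> card B + i * k" unfolding B_def by (intro card_greedy_points_ge perm)
      moreover have "8 * (i * k) + 8 * k \<le> N" using Suc.prems by simp
      ultimately show "N \<le> 4 * card B" using N k(1) by linarith
    qed
    have split: "exp (- real (hits N k (\<pi>(Suc (Suc i) := p)) (Suc i))) =
      exp (- real (hits N k \<pi> i)) * exp (- of_bool (hit N k B p))" for p
    proof -
      have "hits N k (\<pi>(Suc (Suc i) := p)) i = hits N k \<pi> i" by (rule hits_cong) auto
      moreover have "greedy_points N k (\<pi>(Suc (Suc i) := p)) i = B"
        unfolding B_def by (rule greedy_points_cong) auto
      ultimately show ?thesis by (simp add: hits_Suc hit_step_def exp_diff exp_minus field_simps)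
    qed
    have "(\<Sum>p\<in>P. exp (- of_bool (hit N k B p)) :: real) \<le> (\<Sum>p\<in>P. 1 - of_bool (hit N k B p) / 2)"
    proof (rule sum_mono)
      fix p
      have "exp (-1) \<le> (1/2 :: real)"
        using exp_ge_add_one_self[of 1] by (simp add: exp_minus field_simps)
      thus "exp (- of_bool (hit N k B p)) \<le> (1 - of_bool (hit N k B p) / 2 :: real)" by simp
    qed
    also have "\<dots> = fact N * perm_avg {1..N} (\<lambda>p. 1 - (1/2) * of_bool (hit N k B p))"
      by (simp add: perm_avg_def P_def)
    also have "\<dots> = fact N * (1 - (1/2) * perm_avg {1..N} (\<lambda>p. of_bool (hit N k B p)))"
      by (simp only: perm_avg_diff perm_avg_cmult perm_avg_const[OF finite_atLeastAtMost])
    also have "\<dots> \<le> fact N * (1 - (1/2) * (1 / 80000))"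
      using perm_avg_hit_ge[OF k(1) _ B(1) B(3) B(2)] k by (intro mult_left_mono) auto
    also have "\<dots> \<le> fact N * exp (- 1 / 160000)"
      using exp_ge_add_one_self[of "- 1 / 160000"] by (intro mult_left_mono) auto
    finally have "(\<Sum>p\<in>P. exp (- of_bool (hit N k B p)) :: real) \<le> fact N * exp (- 1 / 160000)" .
    thus "(\<Sum>p\<in>P. exp (- real (hits N k (\<pi>(Suc (Suc i) := p)) (Suc i)))) \<le>
      exp (- real (hits N k \<pi> i)) * (fact N * exp (- 1 / 160000))"
      unfolding split sum_distrib_left[symmetric] by (intro mult_left_mono) auto
  qed
  also have "\<dots> = (\<Sum>\<pi>\<in>perm_tuples N (Suc i). exp (- real (hits N k \<pi> i))) * (fact N * exp (- 1 / 160000))"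
    by (simp add: sum_distrib_right)
  also have "\<dots> \<le> fact N ^ Suc i * exp (- real i / 160000) * (fact N * exp (- 1 / 160000))"
    using Suc by (intro mult_right_mono) auto
  also have "\<dots> = fact N ^ Suc (Suc i) * exp (- real i / 160000 + - 1 / 160000)"
    by (simp only: exp_add power_Suc) (simp add: ac_simps)
  also have "- real i / 160000 + - 1 / 160000 = - real (Suc i) / 160000" by simp
  finally show ?case .
qed

text \<open>Markov's inequality for \<open>exp (- hits)\<close>, with the threshold at half of the exponential rate.\<close>

lemma card_few_hits_le:
  assumes N: "4 \<le> N" and k: "0 < k" "8 * (i * k) \<le> N" "8 * k \<le> N"
  shows "real (card {\<pi>\<in>perm_tuples N (Suc i). real (hits N k \<pi> i) < real i / 320000})
    \<le> fact N ^ Suc i * exp (- real i / 320000)"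
proof -
  define T where "T = {\<pi>\<in>perm_tuples N (Suc i). real (hits N k \<pi> i) < real i / 320000}"
  have "real (card T) * exp (- real i / 320000) = (\<Sum>\<pi>\<in>T. exp (- real i / 320000))" by simp
  also have "\<dots> \<le> (\<Sum>\<pi>\<in>T. exp (- real (hits N k \<pi> i)))"
    by (intro sum_mono) (auto simp: T_def)
  also have "\<dots> \<le> (\<Sum>\<pi>\<in>perm_tuples N (Suc i). exp (- real (hits N k \<pi> i)))"
    by (intro sum_mono2 finite_perm_tuples) (auto simp: T_def)
  also have "\<dots> \<le> fact N ^ Suc i * exp (- real i / 320000 + - real i / 320000)"
    using sum_exp_neg_hits_le[OF assms] by simp
  also have "\<dots> = fact N ^ Suc i * exp (- real i / 320000) * exp (- real i / 320000)"
    by (simp only: exp_add mult.assoc)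
  finally show ?thesis unfolding T_def[symmetric] by (simp only: mult_le_cancel_right_pos exp_gt_zero)
qed

section \<open>Hits force a large discrepancy\<close>

definition corner_side :: "nat \<Rightarrow> nat \<Rightarrow> (nat \<Rightarrow> nat \<Rightarrow> nat) \<Rightarrow> nat \<Rightarrow> real" where
  "corner_side N k \<pi> j =
    (if j = 1 then real (N div 2) / real N
     else if hit_step N k \<pi> (j - 2) then 1 - real k / real N else 1)"

lemma corner_side_bounds:
  assumes "k \<le> N" "0 < N"
  shows "0 \<le> corner_side N k \<pi> j" "corner_side N k \<pi> j \<le> 1"
  using assms by (auto simp: corner_side_def field_simps)

text \<open>A cut with \<open>x\<close> points in the slab turns a deficit \<open>D = N * V - card B\<close> into
  \<open>(1 - k / N) * D + (x - k * card B / N)\<close>. The bracket is what a hit bounds from below.\<close>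

lemma greedy_deficit_ge:
  assumes k: "k \<le> N" "0 < N"
    and perm: "\<pi> 1 permutes {1..N}"
  shows "(1 - real k / N) ^ i * (sqrt (real k) / 400) * real (hits N k \<pi> i)
    \<le> real N * (\<Prod>j\<in>{1..Suc i}. corner_side N k \<pi> j) - card (greedy_points N k \<pi> i)"
proof (induction i)
  case 0
  have "corner_side N k \<pi> 1 = real (N div 2) / N" by (simp add: corner_side_def)
  thus ?case using card_greedy_points_0[of \<pi> N k] perm k by (simp add: hits_0)
next
  case (Suc i)
  define B p where "B = greedy_points N k \<pi> i" and "p = \<pi> (Suc (Suc i))"
  define V where "V = (\<Prod>j\<in>{1..Suc i}. corner_side N k \<pi> j)"
  define c where "c = 1 - real k / N"
  define s where "s = sqrt (real k) / 400"
  have c: "0 \<le> c" "c \<le> 1" using k by (auto simp: c_def)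
  have s: "0 \<le> s" by (simp add: s_def)
  have IH: "c ^ i * s * real (hits N k \<pi> i) \<le> real N * V - card B"
    using Suc by (simp add: c_def s_def V_def B_def)
  have RHS: "0 \<le> c ^ i * s * real (hits N k \<pi> i)" using c s by simp
  have V': "(\<Prod>j\<in>{1..Suc (Suc i)}. corner_side N k \<pi> j) = V * corner_side N k \<pi> (Suc (Suc i))"
    unfolding V_def by (simp add: prod.nat_ivl_Suc')
  have "c ^ Suc i * s * real (hits N k \<pi> (Suc i)) \<le>
    real N * (V * corner_side N k \<pi> (Suc (Suc i))) - card (greedy_points N k \<pi> (Suc i))"
  proof (cases "hit_step N k \<pi> i")
    case False
    have "c * (c ^ i * s * real (hits N k \<pi> i)) \<le> 1 * (c ^ i * s * real (hits N k \<pi> i))"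
      using c RHS by (intro mult_right_mono) auto
    hence "c ^ Suc i * s * real (hits N k \<pi> i) \<le> real N * V - card B"
      using IH by (simp add: mult.assoc)
    moreover have "corner_side N k \<pi> (Suc (Suc i)) = 1" using False by (simp add: corner_side_def)
    ultimately show ?thesis using False by (simp add: hits_Suc greedy_points_Suc B_def)
  next
    case True
    define x where "x = card {n\<in>B. N - k < p n}"
    have side: "corner_side N k \<pi> (Suc (Suc i)) = c" using True by (simp add: corner_side_def c_def)
    have "card B = card {n\<in>B. p n \<le> N - k} + x"
      unfolding x_def by (rule card_split_slab) (simp only: B_def finite_greedy_points)
    hence pts: "real (card (greedy_points N k \<pi> (Suc i))) = real (card B) - x"
      using True by (simp add: greedy_points_Suc flip: B_def p_def)
    have x: "real x \<ge> real k * card B / N + s"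
      using True by (simp add: hit_step_def hit_def x_def s_def flip: B_def p_def)
    have "c ^ Suc i * s * real (hits N k \<pi> (Suc i)) = c * (c ^ i * s * real (hits N k \<pi> i)) + c ^ Suc i * s"
      using True by (simp add: hits_Suc algebra_simps)
    also have "\<dots> \<le> c * (real N * V - card B) + 1 * s"
      using IH c s by (intro add_mono mult_left_mono mult_right_mono power_le_one) auto
    also have "\<dots> = real N * (V * c) - card B + (real k * card B / N + s)"
      by (simp add: c_def algebra_simps)
    also have "\<dots> \<le> real N * (V * c) - (real (card B) - real x)" using x by simp
    finally show ?thesis unfolding side pts .
  qed
  thus ?case unfolding V' by (simp add: c_def s_def)
qed

text \<open>A point \<open>(\<pi> j n - u) / N\<close> below \<open>c / N\<close> with an integer \<open>c\<close> and \<open>u < 1\<close> satisfies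
  \<open>\<pi> j n \<le> c\<close>. The converse can fail on the boundary, but only the inclusion is of interest: fewer
  points in the box increase the deficit.\<close>

lemma mem_greedy_points:
  assumes k: "k \<le> N" "0 < N" and n: "n \<in> {1..N}"
    and u: "\<And>j. j \<in> {1..Suc i} \<Longrightarrow> u (n, j) < 1"
    and less: "\<And>j. j \<in> {1..Suc i} \<Longrightarrow> (real (\<pi> j n) - u (n, j)) / N < corner_side N k \<pi> j"
  shows "n \<in> greedy_points N k \<pi> i"
  using u less
proof (induction i)
  case 0
  have "(real (\<pi> 1 n) - u (n, 1)) / N < corner_side N k \<pi> 1" "u (n, 1) < 1" using 0 by auto
  moreover have "corner_side N k \<pi> 1 = real (N div 2) / N" by (simp add: corner_side_def)
  ultimately have "real (\<pi> 1 n) < real (N div 2) + 1" using k by (simp add: divide_less_cancel)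
  thus ?case using n by simp
next
  case (Suc i)
  have IH: "n \<in> greedy_points N k \<pi> i" by (rule Suc.IH) (use Suc.prems in auto)
  define j where "j = Suc (Suc i)"
  have "(real (\<pi> j n) - u (n, j)) / N < corner_side N k \<pi> j" "u (n, j) < 1"
    using Suc.prems by (auto simp: j_def)
  moreover have "corner_side N k \<pi> j = real (N - k) / N" if "hit_step N k \<pi> i"
    using that k by (simp add: corner_side_def j_def of_nat_diff diff_divide_distrib)
  ultimately have "real (\<pi> j n) < real (N - k) + 1" if "hit_step N k \<pi> i"
    using that k by (simp add: divide_less_cancel)
  thus ?case using IH by (auto simp: greedy_points_Suc j_def)
qed

lemma size_latin_hypercube_sample_in:
  "size {#x \<in># latin_hypercube_sample d N (\<pi>, u). x \<in> anchored_box d y#} =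
   card {n\<in>{1..N}. \<forall>j\<in>{1..d}. (real (\<pi> j n) - u (n, j)) / N \<in> {0..<y j}}"
proof -
  have "size {#x \<in># latin_hypercube_sample d N (\<pi>, u). x \<in> anchored_box d y#} =
    card {n\<in>{1..N}. (\<lambda>j\<in>{1..d}. (real (\<pi> j n) - u (n, j)) / N) \<in> anchored_box d y}"
    by (simp add: latin_hypercube_sample_def filter_mset_image_mset filter_mset_mset_set)
  also have "\<dots> = card {n\<in>{1..N}. \<forall>j\<in>{1..d}. (real (\<pi> j n) - u (n, j)) / N \<in> {0..<y j}}"
    by (intro arg_cong[of _ _ card]) (auto simp: anchored_box_def PiE_iff)
  finally show ?thesis .
qed

lemma local_discrepancy_latin_hypercube_sample:
  assumes "\<And>j. j \<in> {1..d} \<Longrightarrow> 0 \<le> y j"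
  shows "local_discrepancy d (latin_hypercube_sample d N (\<pi>, u)) (anchored_box d y) =
    \<bar>card {n\<in>{1..N}. \<forall>j\<in>{1..d}. (real (\<pi> j n) - u (n, j)) / N \<in> {0..<y j}} / N - (\<Prod>j\<in>{1..d}. y j)\<bar>"
  unfolding local_discrepancy_def size_latin_hypercube_sample_in size_latin_hypercube_sample
  by (subst measure_anchored_box) (use assms in auto)

lemma local_discrepancy_le_1:
  assumes y: "y \<in> (\<Pi>\<^sub>E j\<in>{1..d}. {0..1})"
  shows "local_discrepancy d P (anchored_box d y) \<le> 1"
proof -
  have "real (size {#x \<in># P. x \<in> anchored_box d y#}) / real (size P) \<in> {0..1}"
    using size_filter_mset_lesseq[of "\<lambda>x. x \<in> anchored_box d y" P] by (auto simp: divide_le_eq)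
  moreover have "(\<Prod>j\<in>{1..d}. y j) \<in> {0..1}"
    using y by (auto intro!: prod_nonneg prod_le_1 simp: PiE_iff)
  moreover have "measure (lebesgue_dim d) (anchored_box d y) = (\<Prod>j\<in>{1..d}. y j)"
    using y by (intro measure_anchored_box) (auto simp: PiE_iff)
  ultimately show ?thesis unfolding local_discrepancy_def atLeastAtMost_iff by linarith
qed

lemma bdd_above_local_discrepancy:
  "S \<subseteq> (\<Pi>\<^sub>E j\<in>{1..d}. {0..1}) \<Longrightarrow> bdd_above ((\<lambda>y. local_discrepancy d P (anchored_box d y)) ` S)"
  using local_discrepancy_le_1 by (intro bdd_aboveI2[of _ _ 1]) blast

lemma local_discrepancy_le_star_discrepancy:
  "y \<in> (\<Pi>\<^sub>E j\<in>{1..d}. {0..1}) \<Longrightarrow> local_discrepancy d P (anchored_box d y) \<le> star_discrepancy d P"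
  unfolding star_discrepancy_def by (intro cSUP_upper bdd_above_local_discrepancy) auto

lemma star_discrepancy_bounds: "0 \<le> star_discrepancy d P" "star_discrepancy d P \<le> 1"
proof -
  define y where "y = (\<lambda>j\<in>{1..d}. 0 :: real)"
  have y: "y \<in> (\<Pi>\<^sub>E j\<in>{1..d}. {0..1})" by (auto simp: y_def)
  have "0 \<le> local_discrepancy d P (anchored_box d y)" by (simp add: local_discrepancy_def)
  thus "0 \<le> star_discrepancy d P" using local_discrepancy_le_star_discrepancy[OF y, of P] by linarith
  show "star_discrepancy d P \<le> 1"
    unfolding star_discrepancy_def using y by (intro cSUP_least local_discrepancy_le_1) auto
qed

text \<open>By Bernoulli's inequality the accumulated shrinking factor \<open>(1 - k / N) ^ i\<close> is at least
  \<open>1 - i * k / N \<ge> 1 / 2\<close>.\<close>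

lemma star_discrepancy_ge_hits:
  assumes N: "0 < N" "8 * (i * k) \<le> N" "k \<le> N"
    and perm: "\<pi> 1 permutes {1..N}"
    and u: "\<And>n j. n \<in> {1..N} \<Longrightarrow> j \<in> {1..Suc i} \<Longrightarrow> u (n, j) < 1"
  shows "sqrt (real k) / 800 * real (hits N k \<pi> i) / N
    \<le> star_discrepancy (Suc i) (latin_hypercube_sample (Suc i) N (\<pi>, u))"
proof -
  define y where "y = (\<lambda>j\<in>{1..Suc i}. corner_side N k \<pi> j)"
  define C where "C = {n\<in>{1..N}. \<forall>j\<in>{1..Suc i}. (real (\<pi> j n) - u (n, j)) / N \<in> {0..<y j}}"
  have y: "y \<in> (\<Pi>\<^sub>E j\<in>{1..Suc i}. {0..1})"
    using corner_side_bounds[OF N(3) N(1)] by (simp add: y_def)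
  have "C \<subseteq> greedy_points N k \<pi> i"
  proof
    fix n assume n: "n \<in> C"
    show "n \<in> greedy_points N k \<pi> i"
      by (rule mem_greedy_points[OF N(3) N(1), of _ _ u]) (use n u in \<open>auto simp: C_def y_def\<close>)
  qed
  hence "card C \<le> card (greedy_points N k \<pi> i)" by (rule card_mono[OF finite_greedy_points])
  have "1 / 2 \<le> 1 + real i * (- (real k / N))"
  proof -
    have "8 * (real i * real k) \<le> real N" using N(2) by (simp flip: of_nat_mult add: of_nat_le_iff)
    thus ?thesis using N(1) by (simp add: field_simps)
  qed
  also have "\<dots> \<le> (1 + - (real k / N)) ^ i"
    using N by (intro Bernoulli_inequality) auto
  finally have "1 / 2 * (sqrt (real k) / 400 * real (hits N k \<pi> i)) \<le>
    (1 - real k / N) ^ i * (sqrt (real k) / 400 * real (hits N k \<pi> i))"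
    by (intro mult_right_mono) auto
  also have "\<dots> \<le> real N * (\<Prod>j\<in>{1..Suc i}. corner_side N k \<pi> j) - card (greedy_points N k \<pi> i)"
    using greedy_deficit_ge[of k N \<pi> i] N perm by (simp only: mult.assoc)
  also have "\<dots> \<le> real N * (\<Prod>j\<in>{1..Suc i}. y j) - card C"
    using \<open>card C \<le> _\<close> by (simp add: y_def)
  finally have "sqrt (real k) / 800 * real (hits N k \<pi> i) / N \<le> (real N * (\<Prod>j\<in>{1..Suc i}. y j) - card C) / N"
    by (intro divide_right_mono) auto
  also have "\<dots> = (\<Prod>j\<in>{1..Suc i}. y j) - card C / N" using N by (simp add: diff_divide_distrib)
  also have "\<dots> \<le> \<bar>card C / N - (\<Prod>j\<in>{1..Suc i}. y j)\<bar>" by linarith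
  also have "\<dots> = local_discrepancy (Suc i) (latin_hypercube_sample (Suc i) N (\<pi>, u)) (anchored_box (Suc i) y)"
    unfolding C_def using y
    by (intro local_discrepancy_latin_hypercube_sample[symmetric]) (auto simp: PiE_iff)
  also have "\<dots> \<le> star_discrepancy (Suc i) (latin_hypercube_sample (Suc i) N (\<pi>, u))"
    by (rule local_discrepancy_le_star_discrepancy[OF y])
  finally show ?thesis .
qed

section \<open>Measurability of the star discrepancy\<close>

text \<open>Half-open boxes are stable under approximation from below: if \<open>y\<close> is approached by smaller
  rational corners, the volume converges, and the number of points in the box is eventually constant
  because \<open>x < y\<close> is an open condition.\<close>

lemma star_discrepancy_eq_rational_SUP:
  "star_discrepancy d (latin_hypercube_sample d N (\<pi>, u)) =
   (SUP y\<in>(\<Pi>\<^sub>E j\<in>{1..d}. {0..1} \<inter> \<rat>).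
     local_discrepancy d (latin_hypercube_sample d N (\<pi>, u)) (anchored_box d y))"
proof (rule antisym)
  define P where "P = latin_hypercube_sample d N (\<pi>, u)"
  define Q where "Q = (\<Pi>\<^sub>E j\<in>{1..d}. {0..1::real} \<inter> \<rat>)"
  define f where "f = (\<lambda>y. local_discrepancy d P (anchored_box d y))"
  have Q: "Q \<subseteq> (\<Pi>\<^sub>E j\<in>{1..d}. {0..1})" unfolding Q_def by (rule PiE_mono) auto
  have Q0: "(\<lambda>j\<in>{1..d}. 0) \<in> Q" by (auto simp: Q_def)
  show "(SUP y\<in>Q. f y) \<le> star_discrepancy d P"
    using Q Q0 unfolding f_def by (intro cSUP_least local_discrepancy_le_star_discrepancy) auto
  show "star_discrepancy d P \<le> (SUP y\<in>Q. f y)"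
    unfolding star_discrepancy_def f_def[symmetric]
  proof (rule cSUP_least)
    show "(\<Pi>\<^sub>E j\<in>{1..d}. {0..1::real}) \<noteq> {}" using Q Q0 by auto
    fix y :: "nat \<Rightarrow> real" assume y: "y \<in> (\<Pi>\<^sub>E j\<in>{1..d}. {0..1})"
    define X where "X = (\<lambda>n j. (real (\<pi> j n) - u (n, j)) / N)"
    define Y where "Y = (\<lambda>i::nat. \<lambda>j\<in>{1..d}. real_of_int \<lfloor>real (Suc i) * y j\<rfloor> / real (Suc i))"
    have y01: "0 \<le> y j" "y j \<le> 1" if "j \<in> {1..d}" for j using y that by (auto simp: PiE_iff)
    have Y_le: "Y i j \<le> y j" if "j \<in> {1..d}" for i j
    proof -
      have "real_of_int \<lfloor>real (Suc i) * y j\<rfloor> \<le> real (Suc i) * y j" by linarith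
      hence "real_of_int \<lfloor>real (Suc i) * y j\<rfloor> / real (Suc i) \<le> y j"
        by (subst pos_divide_le_eq) (auto simp: mult.commute)
      thus ?thesis using that by (simp add: Y_def)
    qed
    have Y_ge: "y j - 1 / real (Suc i) \<le> Y i j" if "j \<in> {1..d}" for i j
    proof -
      have "real (Suc i) * y j - 1 \<le> real_of_int \<lfloor>real (Suc i) * y j\<rfloor>" by linarith
      hence "(real (Suc i) * y j - 1) / real (Suc i) \<le> real_of_int \<lfloor>real (Suc i) * y j\<rfloor> / real (Suc i)"
        by (intro divide_right_mono) auto
      thus ?thesis using that by (simp add: Y_def diff_divide_distrib del: of_nat_Suc)
    qed
    have YQ: "Y i \<in> Q" for i
    proof -
      have "Y i j \<in> {0..1} \<inter> \<rat>" if "j \<in> {1..d}" for j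
      proof -
        have "0 \<le> Y i j" using y01[OF that] that by (simp add: Y_def)
        moreover have "Y i j \<le> 1" using Y_le[OF that] y01[OF that] by (meson order_trans)
        moreover have "Y i j \<in> \<rat>" using that by (simp add: Y_def)
        ultimately show ?thesis by auto
      qed
      thus ?thesis by (auto simp: Q_def Y_def PiE_iff)
    qed
    have lim: "(\<lambda>i. Y i j) \<longlonglongrightarrow> y j" if "j \<in> {1..d}" for j
    proof (rule tendsto_sandwich[of "\<lambda>i. y j - 1 / real (Suc i)" _ _ "\<lambda>_. y j"])
      show "(\<lambda>i. y j - 1 / real (Suc i)) \<longlonglongrightarrow> y j"
        using tendsto_diff[OF tendsto_const LIMSEQ_inverse_real_of_nat, of "y j"]
        by (simp add: inverse_eq_divide)
    qed (use Y_le[OF that] Y_ge[OF that] in auto)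
    have ev: "eventually (\<lambda>i. \<forall>j\<in>{1..d}. \<forall>n\<in>{1..N}. X n j \<in> {0..<Y i j} \<longleftrightarrow> X n j \<in> {0..<y j}) sequentially"
    proof (intro eventually_ball_finite finite_atLeastAtMost ballI)
      fix j n assume j: "j \<in> {1..d}"
      show "eventually (\<lambda>i. X n j \<in> {0..<Y i j} \<longleftrightarrow> X n j \<in> {0..<y j}) sequentially"
      proof (cases "X n j < y j")
        case True
        from order_tendstoD(1)[OF lim[OF j] True] show ?thesis
          by eventually_elim (use True in auto)
      next
        case False
        have "\<not> X n j < Y i j" for i using Y_le[OF j, of i] False by linarith
        thus ?thesis using False by simp
      qed
    qed
    define c where "c = (\<lambda>y :: nat \<Rightarrow> real. card {n\<in>{1..N}. \<forall>j\<in>{1..d}. X n j \<in> {0..<y j}})"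
    have f_eq: "f z = \<bar>real (c z) / N - (\<Prod>j\<in>{1..d}. z j)\<bar>" if "z \<in> (\<Pi>\<^sub>E j\<in>{1..d}. {0..1})" for z
      unfolding f_def P_def c_def X_def using that
      by (intro local_discrepancy_latin_hypercube_sample) (auto simp: PiE_iff)
    have "(\<lambda>i. \<bar>real (c y) / N - (\<Prod>j\<in>{1..d}. Y i j)\<bar>) \<longlonglongrightarrow> \<bar>real (c y) / N - (\<Prod>j\<in>{1..d}. y j)\<bar>"
      by (intro tendsto_intros lim)
    hence "(\<lambda>i. \<bar>real (c y) / N - (\<Prod>j\<in>{1..d}. Y i j)\<bar>) \<longlonglongrightarrow> f y"
      by (simp only: f_eq[OF y])
    moreover from ev have "eventually (\<lambda>i. \<bar>real (c y) / N - (\<Prod>j\<in>{1..d}. Y i j)\<bar> = f (Y i)) sequentially"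
    proof eventually_elim
      case (elim i)
      have "c (Y i) = c y" unfolding c_def using elim by (intro arg_cong[of _ _ card]) blast
      moreover have "Y i \<in> (\<Pi>\<^sub>E j\<in>{1..d}. {0..1})" using YQ Q by blast
      ultimately show ?case by (simp only: f_eq)
    qed
    ultimately have "(\<lambda>i. f (Y i)) \<longlonglongrightarrow> f y" by (rule Lim_transform_eventually)
    moreover have "f (Y i) \<le> (SUP y\<in>Q. f y)" for i
      unfolding f_def by (rule cSUP_upper[OF YQ bdd_above_local_discrepancy[OF Q]])
    ultimately show "f y \<le> (SUP y\<in>Q. f y)" by (intro LIMSEQ_le_const2) auto
  qed
qed

lemma measurable_lhs_point:
  assumes j: "j \<in> {1..d}" and n: "n \<in> {1..N}"
  shows "(\<lambda>\<omega>. (real (fst \<omega> j n) - snd \<omega> (n, j)) / N) \<in> borel_measurable (lhs_space d N)"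
proof -
  have "(\<lambda>\<omega>. fst \<omega> j) \<in> lhs_space d N \<rightarrow>\<^sub>M measure_pmf (pmf_of_set {p. p permutes {1..N}})"
    unfolding lhs_space_def by (intro measurable_compose[OF measurable_fst] measurable_component_singleton j)
  moreover have "(\<lambda>p. real (p n)) \<in> borel_measurable (measure_pmf (pmf_of_set {p. p permutes {1..N}}))"
    by simp
  ultimately have "(\<lambda>\<omega>. real (fst \<omega> j n)) \<in> borel_measurable (lhs_space d N)"
    by (rule measurable_compose)
  moreover have "(\<lambda>\<omega>. snd \<omega> (n, j)) \<in> lhs_space d N \<rightarrow>\<^sub>M uniform_measure lborel {0..<1}"
    unfolding lhs_space_def using n j
    by (intro measurable_compose[OF measurable_snd] measurable_component_singleton) auto
  hence "(\<lambda>\<omega>. snd \<omega> (n, j)) \<in> borel_measurable (lhs_space d N)"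
    by (simp cong: measurable_cong_sets)
  ultimately show ?thesis by measurable
qed

lemma measurable_star_discrepancy:
  "(\<lambda>\<omega>. star_discrepancy d (latin_hypercube_sample d N \<omega>)) \<in> borel_measurable (lhs_space d N)"
proof -
  define Q where "Q = (\<Pi>\<^sub>E j\<in>{1..d}. {0..1::real} \<inter> \<rat>)"
  have Q: "Q \<subseteq> (\<Pi>\<^sub>E j\<in>{1..d}. {0..1})" unfolding Q_def by (rule PiE_mono) auto
  have "countable Q" unfolding Q_def
    by (intro countable_PiE countable_Int2 countable_rat) auto
  moreover have "(\<lambda>\<omega>. local_discrepancy d (latin_hypercube_sample d N \<omega>) (anchored_box d y))
      \<in> borel_measurable (lhs_space d N)" if "y \<in> Q" for y
  proof -
    have y: "\<And>j. j \<in> {1..d} \<Longrightarrow> 0 \<le> y j" using that by (auto simp: Q_def PiE_iff)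
    have eq: "local_discrepancy d (latin_hypercube_sample d N \<omega>) (anchored_box d y) =
      \<bar>(\<Sum>n\<in>{1..N}. of_bool (\<forall>j\<in>{1..d}. (real (fst \<omega> j n) - snd \<omega> (n, j)) / N \<in> {0..<y j})) / N
        - (\<Prod>j\<in>{1..d}. y j)\<bar>" for \<omega>
      using local_discrepancy_latin_hypercube_sample[OF y, where N = N and \<pi> = "fst \<omega>" and u = "snd \<omega>"]
      by (simp add: sum_of_bool_eq Int_def)
    have [measurable]: "Measurable.pred (lhs_space d N)
      (\<lambda>\<omega>. \<forall>j\<in>{1..d}. (real (fst \<omega> j n) - snd \<omega> (n, j)) / N \<in> {0..<y j})" if "n \<in> {1..N}" for n
    proof (intro pred_intros_finite finite_atLeastAtMost)
      fix j assume "j \<in> {1..d}"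
      note [measurable] = measurable_lhs_point[OF this that]
      show "Measurable.pred (lhs_space d N) (\<lambda>\<omega>. (real (fst \<omega> j n) - snd \<omega> (n, j)) / N \<in> {0..<y j})"
        by measurable
    qed
    have "(\<lambda>\<omega>. \<Sum>n\<in>{1..N}. of_bool (\<forall>j\<in>{1..d}. (real (fst \<omega> j n) - snd \<omega> (n, j)) / N \<in> {0..<y j}) :: real)
      \<in> borel_measurable (lhs_space d N)"
      by (intro borel_measurable_sum) measurable
    thus ?thesis unfolding eq by measurable
  qed
  ultimately have "(\<lambda>\<omega>. SUP y\<in>Q. local_discrepancy d (latin_hypercube_sample d N \<omega>) (anchored_box d y))
      \<in> borel_measurable (lhs_space d N)"
    by (rule borel_measurable_cSUP) (auto intro: bdd_above_local_discrepancy[OF Q])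
  moreover have "star_discrepancy d (latin_hypercube_sample d N \<omega>) =
    (SUP y\<in>Q. local_discrepancy d (latin_hypercube_sample d N \<omega>) (anchored_box d y))" for \<omega>
    using star_discrepancy_eq_rational_SUP[of d N "fst \<omega>" "snd \<omega>"] by (simp add: Q_def)
  ultimately show ?thesis by simp
qed

section \<open>From counting to probabilities\<close>

text \<open>The discrete space of all functions on the naturals is uncountable, and the product
  \<open>\<sigma>\<close>-algebra need not contain every set. It contains every finite set, which suffices, as almost
  surely all coordinates are permutations.\<close>

lemma measure_PiM_perm_set:
  assumes T: "T \<subseteq> perm_tuples N d"
  shows "T \<in> sets (\<Pi>\<^sub>M j\<in>{1..d}. measure_pmf (pmf_of_set {p. p permutes {1..N}}))"
    and "measure (\<Pi>\<^sub>M j\<in>{1..d}. measure_pmf (pmf_of_set {p. p permutes {1..N}})) T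
      = real (card T) / fact N ^ d"
proof -
  define S where "S = {p. p permutes {1..N}}"
  define M where "M = (\<Pi>\<^sub>M j\<in>{1..d}. measure_pmf (pmf_of_set S))"
  have S: "finite S" "S \<noteq> {}" "card S = fact N"
    unfolding S_def by (auto simp: finite_permutations card_permutations intro: exI[of _ id] permutes_id)
  interpret finite_product_prob_space "\<lambda>_. measure_pmf (pmf_of_set S)" "{1..d}"
    by unfold_locales auto
  have single: "{\<pi>} \<in> sets M \<and> measure M {\<pi>} = 1 / fact N ^ d" if "\<pi> \<in> perm_tuples N d" for \<pi>
  proof -
    have ext: "\<pi> \<in> extensional {1..d}" using that by (auto simp: perm_tuples_def PiE_iff)
    have eq: "{\<pi>} = (\<Pi>\<^sub>E j\<in>{1..d}. {\<pi> j})" using PiE_singleton[OF ext] by simp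
    have "{\<pi>} \<in> sets M" unfolding eq M_def by (intro sets_PiM_I_finite) auto
    moreover have "measure M {\<pi>} = (\<Prod>j\<in>{1..d}. measure (measure_pmf (pmf_of_set S)) {\<pi> j})"
      unfolding eq M_def by (intro prob_times) auto
    moreover have "\<dots> = (\<Prod>j\<in>{1..d}. 1 / fact N)"
      using perm_tuplesD[OF that] S
      by (intro prod.cong) (auto simp: measure_pmf_single S_def)
    ultimately show ?thesis by (simp add: power_one_over)
  qed
  have fin: "finite T" using T finite_perm_tuples finite_subset by blast
  have "T = (\<Union>\<pi>\<in>T. {\<pi>})" by simp
  also have "\<dots> \<in> sets M" using single T fin by (intro sets.finite_UN) auto
  finally show "T \<in> sets (\<Pi>\<^sub>M j\<in>{1..d}. measure_pmf (pmf_of_set {p. p permutes {1..N}}))"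
    by (simp only: M_def S_def)
  have "prob_space M" unfolding M_def by (intro prob_space_PiM measure_pmf.prob_space_axioms)
  then interpret M: prob_space M .
  have "measure M T = (\<Sum>\<pi>\<in>T. measure M {\<pi>})"
    using single T fin by (intro M.finite_measure_eq_sum_singleton) auto
  also have "\<dots> = (\<Sum>\<pi>\<in>T. 1 / fact N ^ d)" using single T by (intro sum.cong) auto
  finally show "measure (\<Pi>\<^sub>M j\<in>{1..d}. measure_pmf (pmf_of_set {p. p permutes {1..N}})) T
      = real (card T) / fact N ^ d"
    by (simp add: M_def S_def)
qed

lemma AE_lhs_space:
  "AE \<omega> in lhs_space d N. fst \<omega> \<in> perm_tuples N d \<and> (\<forall>n\<in>{1..N}. \<forall>j\<in>{1..d}. snd \<omega> (n, j) < 1)"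
proof -
  define M1 :: "(nat \<Rightarrow> nat \<Rightarrow> nat) measure"
    where "M1 = (\<Pi>\<^sub>M j\<in>{1..d}. measure_pmf (pmf_of_set {p. p permutes {1..N}}))"
  define M2 :: "(nat \<times> nat \<Rightarrow> real) measure"
    where "M2 = (\<Pi>\<^sub>M nj\<in>{1..N} \<times> {1..d}. uniform_measure lborel {0..<1})"
  have L: "lhs_space d N = M1 \<Otimes>\<^sub>M M2" by (simp add: lhs_space_def M1_def M2_def)
  interpret M1: prob_space M1 unfolding M1_def by (intro prob_space_PiM measure_pmf.prob_space_axioms)
  interpret M2: prob_space M2 unfolding M2_def by (intro prob_space_PiM prob_space_uniform_measure) auto
  have "{p. p permutes {1..N}} \<noteq> {}" "finite {p. p permutes {1..N}}"
    by (auto simp: finite_permutations intro: exI[of _ id] permutes_id)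
  hence "AE p in measure_pmf (pmf_of_set {p. p permutes {1..N}}). p permutes {1..N}"
    by (simp add: AE_measure_pmf_iff)
  hence "AE \<pi> in M1. \<pi> j permutes {1..N}" if "j \<in> {1..d}" for j
    unfolding M1_def using that by (intro AE_PiM_component measure_pmf.prob_space_axioms)
  hence "AE \<pi> in M1. \<forall>j\<in>{1..d}. \<pi> j permutes {1..N}" by (intro AE_finite_allI) auto
  moreover have "AE \<pi> in M1. \<pi> \<in> extensional {1..d}"
    by (rule AE_I2) (auto simp: M1_def space_PiM PiE_iff)
  ultimately have 1: "AE \<pi> in M1. \<pi> \<in> perm_tuples N d"
    by eventually_elim (auto simp: perm_tuples_def PiE_iff)
  have "AE x in uniform_measure lborel {0..<1::real}. x < 1"
    by (rule AE_uniform_measureI) auto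
  hence "AE u in M2. u nj < 1" if "nj \<in> {1..N} \<times> {1..d}" for nj
    unfolding M2_def using that by (intro AE_PiM_component prob_space_uniform_measure) auto
  hence 2: "AE u in M2. \<forall>nj\<in>{1..N} \<times> {1..d}. u nj < 1" by (intro AE_finite_allI) auto
  have "AE \<omega> in M1 \<Otimes>\<^sub>M M2. fst \<omega> \<in> perm_tuples N d"
  proof (rule AE_distrD[OF measurable_fst])
    have "distr (M1 \<Otimes>\<^sub>M M2) M1 fst = M1" by (rule M2.distr_pair_fst)
    thus "AE \<pi> in distr (M1 \<Otimes>\<^sub>M M2) M1 fst. \<pi> \<in> perm_tuples N d" using 1 by metis
  qed
  moreover have "AE \<omega> in M1 \<Otimes>\<^sub>M M2. \<forall>nj\<in>{1..N} \<times> {1..d}. snd \<omega> nj < 1"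
  proof -
    interpret pair_prob_space M1 M2 ..
    have "AE x in M1. AE y in M2. \<forall>nj\<in>{1..N} \<times> {1..d}. snd (x, y) nj < 1" using 2 by simp
    thus ?thesis
      by (rule AE_pair_measure[rotated]) (unfold M1_def M2_def, measurable)
  qed
  ultimately show ?thesis unfolding L by eventually_elim auto
qed

text \<open>Here \<open>k\<close> is about \<open>N / (8 * d)\<close>, so all cuts together remove at most \<open>N / 8\<close> points, and
  \<open>k \<ge> N / (16 * d)\<close>. With \<open>d / 640000\<close> hits this gives the constant
  \<open>1 / (4 * 800 * 640000) = 1 / 2048000000\<close>.\<close>

lemma prob_star_discrepancy_less:
  assumes d: "2 \<le> d" and N: "1600 * d \<le> N"
  shows "measure (lhs_space d N)
      {\<omega> \<in> space (lhs_space d N).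
        star_discrepancy d (latin_hypercube_sample d N \<omega>) < sqrt (real d / real N) / 2048000000}
    \<le> exp (- real d / 640000)"
proof -
  define i where "i = d - 1"
  have di: "d = Suc i" "real d \<le> 2 * real i" using d by (auto simp: i_def)
  define k where "k = N div (8 * d)"
  have kN: "8 * (k * d) \<le> N" unfolding k_def using div_times_less_eq_dividend[of N "8 * d"] by (simp add: ac_simps)
  have k200: "200 \<le> k" unfolding k_def using N d by (subst less_eq_div_iff_mult_less_eq) auto
  have N4: "4 \<le> N" "0 < N" using N d by auto
  have ik: "8 * (i * k) \<le> N" "8 * k \<le> N" "k \<le> N"
  proof -
    have "8 * (i * k) \<le> 8 * (k * d)" "8 * k \<le> 8 * (k * d)" using di by auto
    thus "8 * (i * k) \<le> N" "8 * k \<le> N" using kN by linarith+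
    thus "k \<le> N" by linarith
  qed
  have kge: "real N / (16 * d) \<le> k"
  proof -
    have "N < (k + 1) * (8 * d)"
      unfolding k_def using d by (simp add: dividend_less_div_times add.commute)
    also have "\<dots> \<le> (2 * k) * (8 * d)" using k200 by (intro mult_right_mono) auto
    finally have "N \<le> k * (16 * d)" by simp
    hence "real N \<le> real k * real (16 * d)" by (simp flip: of_nat_mult add: of_nat_le_iff)
    thus ?thesis using d by (simp add: divide_le_eq)
  qed
  define M1 :: "(nat \<Rightarrow> nat \<Rightarrow> nat) measure"
    where "M1 = (\<Pi>\<^sub>M j\<in>{1..d}. measure_pmf (pmf_of_set {p. p permutes {1..N}}))"
  define M2 :: "(nat \<times> nat \<Rightarrow> real) measure"
    where "M2 = (\<Pi>\<^sub>M nj\<in>{1..N} \<times> {1..d}. uniform_measure lborel {0..<1})"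
  have L: "lhs_space d N = M1 \<Otimes>\<^sub>M M2" by (simp add: lhs_space_def M1_def M2_def)
  interpret L: prob_space "lhs_space d N" by (rule prob_space_lhs_space)
  have M1: "prob_space M1" unfolding M1_def by (intro prob_space_PiM measure_pmf.prob_space_axioms)
  interpret M2: prob_space M2 unfolding M2_def by (intro prob_space_PiM prob_space_uniform_measure) auto
  define T where "T = {\<pi>\<in>perm_tuples N d. real (hits N k \<pi> i) < real i / 320000}"
  have T: "T \<in> sets M1" "measure M1 T = real (card T) / fact N ^ d"
    using measure_PiM_perm_set[of T N d] by (auto simp: T_def M1_def)
  define E where "E = fst -` T \<inter> space (lhs_space d N)"
  have E: "E \<in> sets (lhs_space d N)"
    unfolding E_def using T by (intro measurable_sets[of _ _ M1]) (auto simp: L)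
  have "measure (lhs_space d N) E = measure (distr (M1 \<Otimes>\<^sub>M M2) M1 fst) T"
    unfolding E_def L using T by (subst measure_distr) auto
  also have "distr (M1 \<Otimes>\<^sub>M M2) M1 fst = M1" by (rule M2.distr_pair_fst)
  also have "measure M1 T \<le> exp (- real i / 320000)"
  proof -
    have "real (card T) \<le> fact N ^ d * exp (- real i / 320000)"
      unfolding T_def di(1) using N4 k200 ik by (intro card_few_hits_le) auto
    thus ?thesis unfolding T(2) by (subst pos_divide_le_eq) (simp_all add: mult.commute)
  qed
  also have "\<dots> \<le> exp (- real d / 640000)" using di by simp
  finally have PE: "measure (lhs_space d N) E \<le> exp (- real d / 640000)" .
  have "measure (lhs_space d N)
      {\<omega> \<in> space (lhs_space d N).
        star_discrepancy d (latin_hypercube_sample d N \<omega>) < sqrt (real d / real N) / 2048000000}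
    \<le> measure (lhs_space d N) E"
  proof (rule L.finite_measure_mono_AE[OF _ E])
    show "AE \<omega> in lhs_space d N. \<omega> \<in> {\<omega> \<in> space (lhs_space d N).
        star_discrepancy d (latin_hypercube_sample d N \<omega>) < sqrt (real d / real N) / 2048000000}
        \<longrightarrow> \<omega> \<in> E"
      using AE_lhs_space[where d = d and N = N]
    proof eventually_elim
      case (elim \<omega>)
      obtain \<pi> u where \<omega>: "\<omega> = (\<pi>, u)" by (cases \<omega>)
      have \<pi>: "\<pi> \<in> perm_tuples N d" using elim by (simp add: \<omega>)
      have ge: "sqrt (real k) / 800 * real (hits N k \<pi> i) / N
          \<le> star_discrepancy d (latin_hypercube_sample d N \<omega>)"
        unfolding \<omega> di using elim perm_tuplesD[OF \<pi>, of 1] d di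
        by (intro star_discrepancy_ge_hits N4 ik) (auto simp: \<omega>)
      have "sqrt (real d / real N) / 2048000000 \<le> star_discrepancy d (latin_hypercube_sample d N \<omega>)"
        if h: "real i / 320000 \<le> hits N k \<pi> i"
      proof -
        have "sqrt (real N / (16 * d)) \<le> sqrt k" using kge by simp
        hence sk: "sqrt (real N / d) / 4 \<le> sqrt k" by (simp add: real_sqrt_divide real_sqrt_mult)
        have h': "real d / 640000 \<le> hits N k \<pi> i" using h di by simp
        have eq: "sqrt (real d / real N) = sqrt (real N / d) * d / N"
          using N4 d by (simp add: real_sqrt_divide field_simps)
        have "sqrt (real d / real N) / 2048000000 = (sqrt (real N / d) / 4) / 800 * (real d / 640000) / N"
          unfolding eq by simp
        also have "\<dots> \<le> sqrt (real k) / 800 * real (hits N k \<pi> i) / N"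
          using sk h' by (intro divide_right_mono mult_mono) auto
        also note ge
        finally show ?thesis .
      qed
      thus ?case using \<pi>
        by (cases "real i / 320000 \<le> hits N k \<pi> i") (auto simp: E_def T_def \<omega> not_less not_le)
    qed
  qed
  thus ?thesis using PE by linarith
qed

theorem theorem3:
  "\<exists>K>0::real. \<exists>\<kappa>>0::real. \<forall>d N :: nat. d \<ge> 2 \<longrightarrow> N \<ge> 1600 * d \<longrightarrow>
     (\<integral>\<omega>. star_discrepancy d (latin_hypercube_sample d N \<omega>) \<partial>lhs_space d N)
       \<ge> K * sqrt (real d / real N) \<and>
     measure (lhs_space d N)
       {\<omega> \<in> space (lhs_space d N).
          star_discrepancy d (latin_hypercube_sample d N \<omega>) < K * sqrt (real d / real N)}
       \<le> exp (- \<kappa> * real d)"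
proof -
  define c \<kappa> :: real where "c = 1 / 2048000000" and "\<kappa> = 1 / 640000"
  \<comment> \<open>As \<open>d \<ge> 2\<close>, the discrepancy is at least \<open>c * sqrt (d / N)\<close> with probability at least
    \<open>1 - exp (- 2 * \<kappa>)\<close>, so its mean is at least \<open>K * sqrt (d / N)\<close>.\<close>
  define K where "K = c * (1 - exp (- 2 * \<kappa>))"
  have pos: "c > 0" "\<kappa> > 0" "K > 0" "K \<le> c" by (auto simp: c_def \<kappa>_def K_def)
  show ?thesis
  proof (rule exI[of _ K], rule conjI[OF pos(3)], rule exI[of _ \<kappa>], rule conjI[OF pos(2)], intro allI impI)
    fix d N :: nat assume d: "d \<ge> 2" and N: "N \<ge> 1600 * d"
    interpret L: prob_space "lhs_space d N" by (rule prob_space_lhs_space)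
    define D where "D = (\<lambda>\<omega>. star_discrepancy d (latin_hypercube_sample d N \<omega>))"
    define s where "s = sqrt (real d / real N)"
    have s: "0 \<le> s" by (simp add: s_def)
    have [measurable]: "D \<in> borel_measurable (lhs_space d N)"
      unfolding D_def by (rule measurable_star_discrepancy)
    have D: "0 \<le> D \<omega>" "D \<omega> \<le> 1" for \<omega> unfolding D_def by (rule star_discrepancy_bounds)+
    have int: "integrable (lhs_space d N) D"
      by (rule L.integrable_const_bound[of _ 1]) (use D in auto)
    define bad where "bad = {\<omega> \<in> space (lhs_space d N). D \<omega> < c * s}"
    have bad: "measure (lhs_space d N) bad \<le> exp (- \<kappa> * real d)"
      using prob_star_discrepancy_less[OF d N] by (simp add: bad_def D_def s_def c_def \<kappa>_def)
    have bad_sets: "bad \<in> sets (lhs_space d N)" unfolding bad_def by measurable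
    have "K * s \<le> c * s * (1 - exp (- \<kappa> * real d))"
    proof -
      have "exp (- \<kappa> * real d) \<le> exp (- 2 * \<kappa>)" using d pos by simp
      hence "c * s * (1 - exp (- 2 * \<kappa>)) \<le> c * s * (1 - exp (- \<kappa> * real d))"
        using pos s by (intro mult_left_mono) auto
      thus ?thesis by (simp add: K_def mult_ac)
    qed
    also have "\<dots> \<le> c * s * (1 - measure (lhs_space d N) bad)"
      using bad pos s by (intro mult_left_mono) auto
    also have "\<dots> = c * s * measure (lhs_space d N) (space (lhs_space d N) - bad)"
      using bad_sets by (simp add: L.prob_compl)
    also have "\<dots> \<le> (\<integral>\<omega>. D \<omega> \<partial>lhs_space d N)"
    proof -
      have "c * s * measure (lhs_space d N) (space (lhs_space d N) - bad) =
        (\<integral>\<omega>. c * s * indicator (space (lhs_space d N) - bad) \<omega> \<partial>lhs_space d N)"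
        using bad_sets by simp
      also have "\<dots> \<le> (\<integral>\<omega>. D \<omega> \<partial>lhs_space d N)"
      proof (rule integral_mono[OF _ int])
        show "integrable (lhs_space d N) (\<lambda>\<omega>. c * s * indicator (space (lhs_space d N) - bad) \<omega>)"
          using bad_sets by (intro integrable_mult_right) (auto simp: L.emeasure_finite less_top[symmetric])
      qed (use D in \<open>auto simp: bad_def indicator_def\<close>)
      finally show ?thesis .
    qed
    finally have E: "K * s \<le> (\<integral>\<omega>. D \<omega> \<partial>lhs_space d N)" .
    have "measure (lhs_space d N) {\<omega> \<in> space (lhs_space d N). D \<omega> < K * s} \<le> measure (lhs_space d N) bad"
    proof (rule L.finite_measure_mono[OF _ bad_sets])
      have "K * s \<le> c * s" using pos s by (intro mult_right_mono)
      thus "{\<omega> \<in> space (lhs_space d N). D \<omega> < K * s} \<subseteq> bad" by (auto simp: bad_def)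
    qed
    with bad have "measure (lhs_space d N) {\<omega> \<in> space (lhs_space d N). D \<omega> < K * s} \<le> exp (- \<kappa> * real d)"
      by linarith
    with E show "(\<integral>\<omega>. star_discrepancy d (latin_hypercube_sample d N \<omega>) \<partial>lhs_space d N)
       \<ge> K * sqrt (real d / real N) \<and>
     measure (lhs_space d N)
       {\<omega> \<in> space (lhs_space d N).
          star_discrepancy d (latin_hypercube_sample d N \<omega>) < K * sqrt (real d / real N)}
       \<le> exp (- \<kappa> * real d)"
      by (simp only: D_def s_def)
  qed
qed

end
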